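(* Let $H$ and $K$ be infinite quasiconvex subgroups of a negatively curved group $G$. Assume that $H$ is malnormal in $G$ and residually finite. If the intersection of $H$ and $K$ is trivial, then there exists an infinite family of distinct finite index subgroups $H_m$ of $H$ such that, for every $m$, the subgroup $\langle H_m, K\rangle$ is quasiconvex in $G$ and $\langle H_m, K\rangle = H_m * K$.
   Context: $G$ is a group with a fixed finite generating set $X$, and $X^* = \{x, x^{-1} : x \in X\}$. $\mathrm{Cayley}(G)$ is the Cayley graph of $G$ with respect to $X^*$: its vertex set is $G$, its edge set is $G \times X^*$, and the edge $(g,x)$ joins $g$ to $gx$. A geodesic is a shortest path joining two vertices of $\mathrm{Cayley}(G)$. The group $G$ is negatively curved if for some $\delta \ge 0$ it is $\delta$-negatively curved, i.e. any side of any geodesic triangle in $\mathrm{Cayley}(G)$ belongs to the $\delta$-neighborhood of the union of the two other sides. A subgroup $H$ of $G$ is quasiconvex in $G$ if for some $\mu \ge 0$ any geodesic in $\mathrm{Cayley}(G)$ with both endpoints in $H$ belongs to the $\mu$-neighborhood of $H$. A subgroup $H$ is malnormal in $G$ if for any $g \in G$ with $g \notin H$ the intersection of $H$ and $gHg^{-1}$ is trivial. A group $H$ is residually finite if for any finite set of non-trivial elements of $H$ there exists a finite index subgroup of $H$ which does not contain any element of this set. $\langle A, B\rangle$ denotes the smallest subgroup of $G$ containing the subgroups $A$ and $B$, and $\langle A, B\rangle = A * B$ means that the natural homomorphism from the free product $A * B$ to $\langle A, B\rangle$, induced by the inclusions, is an isomorphism. *)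

theory Defs
  imports "HOL-Algebra.Generated_Groups" "Graph_Theory.Arc_Walk"
begin

section \<open>Geometry of Cayley graphs\<close>

definition sym_gens :: "('a, 'm) monoid_scheme \<Rightarrow> 'a set \<Rightarrow> 'a set" where
  "sym_gens G X = X \<union> m_inv G ` X"

definition cayley_graph :: "('a, 'm) monoid_scheme \<Rightarrow> 'a set \<Rightarrow> ('a, 'a \<times> 'a) pre_digraph" where
  "cayley_graph G X =
    \<lparr>verts = carrier G, arcs = carrier G \<times> sym_gens G X,
     tail = fst, head = (\<lambda>(g, x). g \<otimes>\<^bsub>G\<^esub> x)\<rparr>"

text \<open>Since the arcs of a Cayley graph come in mutually inverse pairs, its (undirected) paths are
  its arc walks.\<close>

definition geodesic :: "('a, 'b) pre_digraph \<Rightarrow> 'a \<Rightarrow> 'b awalk \<Rightarrow> 'a \<Rightarrow> bool" where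
  "geodesic \<Gamma> u p v \<longleftrightarrow>
    pre_digraph.awalk \<Gamma> u p v \<and> (\<forall>q. pre_digraph.awalk \<Gamma> u q v \<longrightarrow> length p \<le> length q)"

text \<open>A path is identified with the set of the vertices on it, and neighbourhoods are taken among
  the vertices. Admitting interior points of edges as well would change the constants
  \<open>\<delta>\<close> and \<open>\<mu>\<close> below by a bounded amount only.\<close>

definition path_vertices :: "('a, 'b) pre_digraph \<Rightarrow> 'a \<Rightarrow> 'b awalk \<Rightarrow> 'a set" where
  "path_vertices \<Gamma> u p = set (pre_digraph.awalk_verts \<Gamma> u p)"

definition graph_neighborhood :: "('a, 'b) pre_digraph \<Rightarrow> real \<Rightarrow> 'a set \<Rightarrow> 'a set" where
  "graph_neighborhood \<Gamma> d S =
    {v. \<exists>s\<in>S. \<exists>p. pre_digraph.awalk \<Gamma> s p v \<and> real (length p) \<le> d}"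

definition delta_negatively_curved :: "('a, 'm) monoid_scheme \<Rightarrow> 'a set \<Rightarrow> real \<Rightarrow> bool" where
  "delta_negatively_curved G X \<delta> \<longleftrightarrow>
    (let \<Gamma> = cayley_graph G X in
      \<forall>a b c p q r. geodesic \<Gamma> a p b \<and> geodesic \<Gamma> b q c \<and> geodesic \<Gamma> c r a \<longrightarrow>
        path_vertices \<Gamma> a p
          \<subseteq> graph_neighborhood \<Gamma> \<delta> (path_vertices \<Gamma> b q \<union> path_vertices \<Gamma> c r) \<and>
        path_vertices \<Gamma> b q
          \<subseteq> graph_neighborhood \<Gamma> \<delta> (path_vertices \<Gamma> c r \<union> path_vertices \<Gamma> a p) \<and>
        path_vertices \<Gamma> c r
          \<subseteq> graph_neighborhood \<Gamma> \<delta> (path_vertices \<Gamma> a p \<union> path_vertices \<Gamma> b q))"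

definition negatively_curved :: "('a, 'm) monoid_scheme \<Rightarrow> 'a set \<Rightarrow> bool" where
  "negatively_curved G X \<longleftrightarrow> (\<exists>\<delta>\<ge>0. delta_negatively_curved G X \<delta>)"

definition quasiconvex :: "('a, 'm) monoid_scheme \<Rightarrow> 'a set \<Rightarrow> 'a set \<Rightarrow> bool" where
  "quasiconvex G X H \<longleftrightarrow>
    (\<exists>\<mu>\<ge>0. \<forall>u\<in>H. \<forall>v\<in>H. \<forall>p. geodesic (cayley_graph G X) u p v \<longrightarrow>
      path_vertices (cayley_graph G X) u p \<subseteq> graph_neighborhood (cayley_graph G X) \<mu> H)"


section \<open>Subgroups\<close>

definition malnormal :: "('a, 'm) monoid_scheme \<Rightarrow> 'a set \<Rightarrow> bool" where
  "malnormal G H \<longleftrightarrow>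
    (\<forall>g \<in> carrier G - H. H \<inter> (g <#\<^bsub>G\<^esub> H #>\<^bsub>G\<^esub> inv\<^bsub>G\<^esub> g) = {\<one>\<^bsub>G\<^esub>})"

definition finite_index_subgroup :: "'a set \<Rightarrow> ('a, 'm) monoid_scheme \<Rightarrow> bool" where
  "finite_index_subgroup L H \<longleftrightarrow> subgroup L H \<and> finite (rcosets\<^bsub>H\<^esub> L)"

definition residually_finite :: "('a, 'm) monoid_scheme \<Rightarrow> bool" where
  "residually_finite H \<longleftrightarrow>
    (\<forall>F. finite F \<and> F \<subseteq> carrier H - {\<one>\<^bsub>H\<^esub>} \<longrightarrow>
      (\<exists>L. finite_index_subgroup L H \<and> L \<inter> F = {}))"


section \<open>Free products of two groups\<close>

text \<open>The free product consists of the words in the disjoint union of the factors, modulo the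
  congruence that deletes identity letters and multiplies adjacent letters of the same factor.\<close>

definition free_product_words ::
    "('a, 'm) monoid_scheme \<Rightarrow> ('b, 'n) monoid_scheme \<Rightarrow> ('a + 'b) list set" where
  "free_product_words A B = lists (Inl ` carrier A \<union> Inr ` carrier B)"

inductive_set free_product_rel ::
    "('a, 'm) monoid_scheme \<Rightarrow> ('b, 'n) monoid_scheme \<Rightarrow> (('a + 'b) list \<times> ('a + 'b) list) set"
  for A :: "('a, 'm) monoid_scheme" and B :: "('b, 'n) monoid_scheme" where
  one_left: "([Inl \<one>\<^bsub>A\<^esub>], []) \<in> free_product_rel A B"
| one_right: "([Inr \<one>\<^bsub>B\<^esub>], []) \<in> free_product_rel A B"
| mult_left: "a \<in> carrier A \<Longrightarrow> a' \<in> carrier A \<Longrightarrow>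
    ([Inl a, Inl a'], [Inl (a \<otimes>\<^bsub>A\<^esub> a')]) \<in> free_product_rel A B"
| mult_right: "b \<in> carrier B \<Longrightarrow> b' \<in> carrier B \<Longrightarrow>
    ([Inr b, Inr b'], [Inr (b \<otimes>\<^bsub>B\<^esub> b')]) \<in> free_product_rel A B"
| refl: "u \<in> free_product_words A B \<Longrightarrow> (u, u) \<in> free_product_rel A B"
| sym: "(u, v) \<in> free_product_rel A B \<Longrightarrow> (v, u) \<in> free_product_rel A B"
| trans: "(u, v) \<in> free_product_rel A B \<Longrightarrow> (v, w) \<in> free_product_rel A B \<Longrightarrow>
    (u, w) \<in> free_product_rel A B"
| append: "(u, v) \<in> free_product_rel A B \<Longrightarrow> (u', v') \<in> free_product_rel A B \<Longrightarrow>
    (u @ u', v @ v') \<in> free_product_rel A B"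

definition free_product ::
    "('a, 'm) monoid_scheme \<Rightarrow> ('b, 'n) monoid_scheme \<Rightarrow> ('a + 'b) list set monoid" where
  "free_product A B =
    \<lparr>carrier = free_product_words A B // free_product_rel A B,
     mult = (\<lambda>U V. \<Union>u\<in>U. \<Union>v\<in>V. free_product_rel A B `` {u @ v}),
     one = free_product_rel A B `` {[]}\<rparr>"

definition word_eval ::
    "('c, 'k) monoid_scheme \<Rightarrow> ('a \<Rightarrow> 'c) \<Rightarrow> ('b \<Rightarrow> 'c) \<Rightarrow> ('a + 'b) list \<Rightarrow> 'c" where
  "word_eval C f g w = foldr (\<lambda>s c. case_sum f g s \<otimes>\<^bsub>C\<^esub> c) w \<one>\<^bsub>C\<^esub>"

text \<open>The homomorphism from a free product to \<open>C\<close> induced by homomorphisms \<open>f\<close> and \<open>g\<close> on the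
  factors: evaluation takes a single value on each congruence class.\<close>

definition free_product_lift ::
    "('c, 'k) monoid_scheme \<Rightarrow> ('a \<Rightarrow> 'c) \<Rightarrow> ('b \<Rightarrow> 'c) \<Rightarrow> ('a + 'b) list set \<Rightarrow> 'c" where
  "free_product_lift C f g U = the_elem (word_eval C f g ` U)"

definition is_internal_free_product ::
    "('a, 'm) monoid_scheme \<Rightarrow> 'a set \<Rightarrow> 'a set \<Rightarrow> bool" where
  "is_internal_free_product G A B \<longleftrightarrow>
    free_product_lift G id id
      \<in> iso (free_product (G\<lparr>carrier := A\<rparr>) (G\<lparr>carrier := B\<rparr>))
            (G\<lparr>carrier := generate G (A \<union> B)\<rparr>)"


subsection \<open>The group structure and the universal property\<close>

lemma free_product_words_append [simp]:
  "u @ v \<in> free_product_words A B \<longleftrightarrow> u \<in> free_product_words A B \<and> v \<in> free_product_words A B"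
  by (auto simp: free_product_words_def)

lemma free_product_words_Nil [simp]: "[] \<in> free_product_words A B"
  by (simp add: free_product_words_def)

lemma free_product_rel_words:
  assumes "group A" "group B" "(u, v) \<in> free_product_rel A B"
  shows "u \<in> free_product_words A B \<and> v \<in> free_product_words A B"
proof -
  interpret A: group A by fact
  interpret B: group B by fact
  show ?thesis using assms(3)
  proof (induction rule: free_product_rel.induct)
    case (append u v u' v')
    then show ?case by simp
  qed (simp_all add: free_product_words_def)
qed

lemma equiv_free_product_rel:
  assumes "group A" "group B"
  shows "equiv (free_product_words A B) (free_product_rel A B)"
proof (rule equivI)
  show "free_product_rel A B \<subseteq> free_product_words A B \<times> free_product_words A B"
    using free_product_rel_words[OF assms] by auto
  show "refl_on (free_product_words A B) (free_product_rel A B)"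
    by (auto simp: refl_on_def intro: free_product_rel.refl)
  show "sym (free_product_rel A B)"
    by (rule symI) (rule free_product_rel.sym)
  show "trans (free_product_rel A B)"
    by (rule transI) (rule free_product_rel.trans)
qed

lemma free_product_mult_class:
  assumes "group A" "group B" "u \<in> free_product_words A B" "v \<in> free_product_words A B"
  shows "free_product_rel A B `` {u} \<otimes>\<^bsub>free_product A B\<^esub> free_product_rel A B `` {v}
    = free_product_rel A B `` {u @ v}" (is "?l = ?r")
proof -
  note eq = equiv_free_product_rel[OF assms(1,2)]
  have "free_product_rel A B `` {u' @ v'} = ?r"
    if "(u, u') \<in> free_product_rel A B" "(v, v') \<in> free_product_rel A B" for u' v'
    using equiv_class_eq[OF eq free_product_rel.append[OF that]] by simp
  then have "(\<Union>u'\<in>free_product_rel A B `` {u}. \<Union>v'\<in>free_product_rel A B `` {v}.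
      free_product_rel A B `` {u' @ v'})
    = (\<Union>u'\<in>free_product_rel A B `` {u}. \<Union>v'\<in>free_product_rel A B `` {v}. ?r)"
    by (intro SUP_cong) simp_all
  moreover have "u \<in> free_product_rel A B `` {u}" "v \<in> free_product_rel A B `` {v}"
    using assms(3,4) by (simp_all add: free_product_rel.refl)
  ultimately show ?thesis
    unfolding free_product_def by (simp only: monoid.simps) blast
qed

lemma free_product_carrierE:
  assumes "U \<in> carrier (free_product A B)"
  obtains u where "u \<in> free_product_words A B" "U = free_product_rel A B `` {u}"
  using assms that by (auto simp: free_product_def quotient_def)

lemma free_product_class_carrier:
  "u \<in> free_product_words A B \<Longrightarrow> free_product_rel A B `` {u} \<in> carrier (free_product A B)"
  by (simp add: free_product_def quotientI)

lemma free_product_one: "\<one>\<^bsub>free_product A B\<^esub> = free_product_rel A B `` {[]}"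
  by (simp add: free_product_def)

lemma free_product_word_inverse:
  assumes "group A" "group B" "w \<in> free_product_words A B"
  shows "\<exists>w'\<in>free_product_words A B. (w' @ w, []) \<in> free_product_rel A B"
proof -
  interpret A: group A by fact
  interpret B: group B by fact
  note eq = equiv_free_product_rel[OF assms(1,2)]
  show ?thesis
    using assms(3)
  proof (induction w)
    case Nil
    have "([] @ [], []) \<in> free_product_rel A B" by (auto intro: free_product_rel.refl)
    then show ?case using free_product_words_Nil by blast
  next
    case (Cons s w)
    have s: "s \<in> Inl ` carrier A \<union> Inr ` carrier B" and w: "w \<in> free_product_words A B"
      using Cons.prems by (auto simp: free_product_words_def)
    obtain w' where w': "w' \<in> free_product_words A B" "(w' @ w, []) \<in> free_product_rel A B"
      using Cons.IH[OF w] by blast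
    obtain t where t: "[t] \<in> free_product_words A B" "([t, s], []) \<in> free_product_rel A B"
    proof (cases s)
      case (Inl a)
      then have a: "a \<in> carrier A" using s by auto
      have "([Inl (inv\<^bsub>A\<^esub> a), Inl a], []) \<in> free_product_rel A B"
        using free_product_rel.trans[OF free_product_rel.mult_left[of "inv\<^bsub>A\<^esub> a" A a B]] a
        by (simp add: free_product_rel.one_left)
      with a Inl show thesis by (intro that[of "Inl (inv\<^bsub>A\<^esub> a)"]) (auto simp: free_product_words_def)
    next
      case (Inr b)
      then have b: "b \<in> carrier B" using s by auto
      have "([Inr (inv\<^bsub>B\<^esub> b), Inr b], []) \<in> free_product_rel A B"
        using free_product_rel.trans[OF free_product_rel.mult_right[of "inv\<^bsub>B\<^esub> b" B b A]] b
        by (simp add: free_product_rel.one_right)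
      with b Inr show thesis by (intro that[of "Inr (inv\<^bsub>B\<^esub> b)"]) (auto simp: free_product_words_def)
    qed
    have "(w' @ [t, s] @ w, w' @ [] @ w) \<in> free_product_rel A B"
      by (rule free_product_rel.append[OF free_product_rel.refl[OF w'(1)]
            free_product_rel.append[OF t(2) free_product_rel.refl[OF w]]])
    then have "((w' @ [t]) @ s # w, []) \<in> free_product_rel A B"
      using free_product_rel.trans[OF _ w'(2)] by simp
    moreover have "w' @ [t] \<in> free_product_words A B" using w' t by simp
    ultimately show ?case by blast
  qed
qed

lemma group_free_product:
  assumes "group A" "group B"
  shows "group (free_product A B)"
proof (rule groupI)
  note mult = free_product_mult_class[OF assms]
  fix U V
  assume "U \<in> carrier (free_product A B)" "V \<in> carrier (free_product A B)"
  then show "U \<otimes>\<^bsub>free_product A B\<^esub> V \<in> carrier (free_product A B)"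
    by (elim free_product_carrierE) (auto simp: mult intro!: free_product_class_carrier)
next
  show "\<one>\<^bsub>free_product A B\<^esub> \<in> carrier (free_product A B)"
    by (auto simp: free_product_one intro!: free_product_class_carrier)
next
  note mult = free_product_mult_class[OF assms]
  fix U V W
  assume "U \<in> carrier (free_product A B)" "V \<in> carrier (free_product A B)"
    "W \<in> carrier (free_product A B)"
  then show "U \<otimes>\<^bsub>free_product A B\<^esub> V \<otimes>\<^bsub>free_product A B\<^esub> W
    = U \<otimes>\<^bsub>free_product A B\<^esub> (V \<otimes>\<^bsub>free_product A B\<^esub> W)"
    by (elim free_product_carrierE) (auto simp: mult)
next
  note mult = free_product_mult_class[OF assms]
  fix U
  assume "U \<in> carrier (free_product A B)"
  then obtain u where u: "u \<in> free_product_words A B" "U = free_product_rel A B `` {u}"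
    by (rule free_product_carrierE)
  show "\<one>\<^bsub>free_product A B\<^esub> \<otimes>\<^bsub>free_product A B\<^esub> U = U"
    using u by (simp add: free_product_one mult)
  obtain w where w: "w \<in> free_product_words A B" "(w @ u, []) \<in> free_product_rel A B"
    using free_product_word_inverse[OF assms u(1)] by blast
  have "free_product_rel A B `` {w} \<otimes>\<^bsub>free_product A B\<^esub> U = \<one>\<^bsub>free_product A B\<^esub>"
    using u w equiv_class_eq[OF equiv_free_product_rel[OF assms] w(2)]
    by (simp add: free_product_one mult)
  then show "\<exists>V\<in>carrier (free_product A B). V \<otimes>\<^bsub>free_product A B\<^esub> U = \<one>\<^bsub>free_product A B\<^esub>"
    using w by (auto intro: free_product_class_carrier)
qed

lemma word_eval_Nil [simp]: "word_eval C f g [] = \<one>\<^bsub>C\<^esub>"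
  by (simp add: word_eval_def)

lemma word_eval_Cons [simp]:
  "word_eval C f g (s # w) = case_sum f g s \<otimes>\<^bsub>C\<^esub> word_eval C f g w"
  by (simp add: word_eval_def)

context
  fixes A :: "('a, 'm) monoid_scheme" and B :: "('b, 'n) monoid_scheme"
    and C :: "('c, 'k) monoid_scheme" and f g
  assumes groups: "group A" "group B" "group C"
    and homs: "f \<in> hom A C" "g \<in> hom B C"
begin

interpretation A: group A by (rule groups)
interpretation B: group B by (rule groups)
interpretation C: group C by (rule groups)
interpretation f: group_hom A C f by unfold_locales (rule homs)
interpretation g: group_hom B C g by unfold_locales (rule homs)

lemma word_eval_closed:
  "w \<in> free_product_words A B \<Longrightarrow> word_eval C f g w \<in> carrier C"
  by (induction w) (auto simp: free_product_words_def)

lemma word_eval_append: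
  "u \<in> free_product_words A B \<Longrightarrow> v \<in> free_product_words A B \<Longrightarrow>
    word_eval C f g (u @ v) = word_eval C f g u \<otimes>\<^bsub>C\<^esub> word_eval C f g v"
proof (induction u)
  case Nil
  then show ?case by (simp add: word_eval_closed)
next
  case (Cons s u)
  have s: "s \<in> Inl ` carrier A \<union> Inr ` carrier B" and u: "u \<in> free_product_words A B"
    using Cons.prems by (auto simp: free_product_words_def)
  have "case_sum f g s \<in> carrier C"
    using s by auto
  then show ?case
    using Cons.IH[OF u Cons.prems(2)] word_eval_closed[OF u] word_eval_closed[OF Cons.prems(2)]
    by (simp add: C.m_assoc)
qed

lemma word_eval_cong:
  "(u, v) \<in> free_product_rel A B \<Longrightarrow> word_eval C f g u = word_eval C f g v"
proof (induction rule: free_product_rel.induct)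
  case (append u v u' v')
  then show ?case
    using free_product_rel_words[OF groups(1,2) append.hyps(1)]
      free_product_rel_words[OF groups(1,2) append.hyps(2)]
    by (simp add: word_eval_append)
qed (auto simp: C.m_assoc)

lemma free_product_lift_class:
  assumes "w \<in> free_product_words A B"
  shows "free_product_lift C f g (free_product_rel A B `` {w}) = word_eval C f g w"
proof -
  have "w \<in> free_product_rel A B `` {w}"
    using free_product_rel.refl[OF assms] by simp
  then show ?thesis
    unfolding free_product_lift_def
    by (intro the_elem_image_unique) (auto dest: word_eval_cong)
qed

lemma free_product_lift_hom: "free_product_lift C f g \<in> hom (free_product A B) C"
proof (rule homI)
  fix U
  assume "U \<in> carrier (free_product A B)"
  then show "free_product_lift C f g U \<in> carrier C"
    by (elim free_product_carrierE) (simp add: free_product_lift_class word_eval_closed)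
next
  fix U V
  assume "U \<in> carrier (free_product A B)" "V \<in> carrier (free_product A B)"
  then show "free_product_lift C f g (U \<otimes>\<^bsub>free_product A B\<^esub> V)
    = free_product_lift C f g U \<otimes>\<^bsub>C\<^esub> free_product_lift C f g V"
    by (elim free_product_carrierE)
      (simp add: free_product_lift_class free_product_mult_class[OF groups(1,2)] word_eval_append)
qed

lemma free_product_lift_Inl:
  "a \<in> carrier A \<Longrightarrow> free_product_lift C f g (free_product_rel A B `` {[Inl a]}) = f a"
  by (subst free_product_lift_class) (auto simp: free_product_words_def)

lemma free_product_lift_Inr:
  "b \<in> carrier B \<Longrightarrow> free_product_lift C f g (free_product_rel A B `` {[Inr b]}) = g b"
  by (subst free_product_lift_class) (auto simp: free_product_words_def)

lemma free_product_lift_unique: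
  assumes h: "h \<in> hom (free_product A B) C"
    and l: "\<And>a. a \<in> carrier A \<Longrightarrow> h (free_product_rel A B `` {[Inl a]}) = f a"
    and r: "\<And>b. b \<in> carrier B \<Longrightarrow> h (free_product_rel A B `` {[Inr b]}) = g b"
    and U: "U \<in> carrier (free_product A B)"
  shows "h U = free_product_lift C f g U"
proof -
  interpret P: group "free_product A B" by (rule group_free_product[OF groups(1,2)])
  interpret h: group_hom "free_product A B" C h by unfold_locales (rule h)
  have "h (free_product_rel A B `` {w}) = word_eval C f g w" if "w \<in> free_product_words A B" for w
    using that
  proof (induction w)
    case Nil
    then show ?case using h.hom_one by (simp add: free_product_one)
  next
    case (Cons s w)
    have s: "s \<in> Inl ` carrier A \<union> Inr ` carrier B" and w: "w \<in> free_product_words A B"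
      using Cons.prems by (auto simp: free_product_words_def)
    have sw: "[s] \<in> free_product_words A B"
      using s by (auto simp: free_product_words_def)
    have "h (free_product_rel A B `` {s # w})
      = h (free_product_rel A B `` {[s]} \<otimes>\<^bsub>free_product A B\<^esub> free_product_rel A B `` {w})"
      using free_product_mult_class[OF groups(1,2) sw w] by simp
    also have "\<dots> = h (free_product_rel A B `` {[s]}) \<otimes>\<^bsub>C\<^esub> h (free_product_rel A B `` {w})"
      using sw w by (intro h.hom_mult free_product_class_carrier)
    also have "\<dots> = word_eval C f g (s # w)"
      using s l r Cons.IH[OF w] by auto
    finally show ?case .
  qed
  then show ?thesis
    using U by (elim free_product_carrierE) (simp add: free_product_lift_class)
qed

end

end

theory Submission
  imports Defs
begin

text \<open>Distances are only used through the word metric, and geodesics only through the relation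
  ``\<open>x\<close> lies between \<open>u\<close> and \<open>v\<close>''. If \<open>A\<close> meets \<open>g B g\<inverse>\<close> trivially, for quasiconvex subgroups
  \<open>A\<close> and \<open>B\<close>, then the Gromov products of \<open>\<alpha> \<in> A\<close> and \<open>g \<beta> \<in> g B\<close> are bounded. Since \<open>H\<close> meets \<open>K\<close>
  trivially and is malnormal, this bounds the Gromov products of \<open>h\<close> with \<open>k\<close> and with \<open>k h'\<close>, for
  \<open>1 \<noteq> k \<in> K\<close>; the second bound is uniform in \<open>k\<close> because for long \<open>k\<close> it follows from the first.
  By residual finiteness, a finite index subgroup \<open>L\<close> of \<open>H\<close> avoids all short nontrivial elements of
  \<open>H\<close>. Along an alternating word in \<open>L\<close> and \<open>K\<close>, the Gromov product at every break point is then
  bounded by induction, even if some letters from \<open>K\<close> are short. Hence such a word is nontrivial, and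
  its break points lie close to every geodesic between its ends, which gives quasiconvexity.
  Avoiding moreover one nontrivial element of each member of a given finite family of such \<open>L\<close>
  yields a new one.\<close>

section \<open>Gromov products\<close>

text \<open>The properties of the word metric of a negatively curved group on which the argument
  rests. Vertices with additive distances replace geodesic paths, and \<open>thin\<close> speaks of
  one side because the others follow by relabelling. Integer values let geodesics be followed by
  induction; finite balls feed the pigeonhole arguments.\<close>

locale hyperbolic_group = group G for G (structure) +
  fixes d :: "'a \<Rightarrow> 'a \<Rightarrow> real" and \<delta> :: real
  assumes d_Nats: "x \<in> carrier G \<Longrightarrow> y \<in> carrier G \<Longrightarrow> d x y \<in> \<nat>"
    and d_eq_0_iff: "x \<in> carrier G \<Longrightarrow> y \<in> carrier G \<Longrightarrow> d x y = 0 \<longleftrightarrow> x = y"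
    and d_commute: "x \<in> carrier G \<Longrightarrow> y \<in> carrier G \<Longrightarrow> d x y = d y x"
    and d_triangle: "x \<in> carrier G \<Longrightarrow> y \<in> carrier G \<Longrightarrow> z \<in> carrier G \<Longrightarrow> d x z \<le> d x y + d y z"
    and d_left: "g \<in> carrier G \<Longrightarrow> x \<in> carrier G \<Longrightarrow> y \<in> carrier G \<Longrightarrow> d (g \<otimes> x) (g \<otimes> y) = d x y"
    and finite_ball: "finite {x \<in> carrier G. d \<one> x \<le> r}"
    and geodesic_point: "x \<in> carrier G \<Longrightarrow> y \<in> carrier G \<Longrightarrow> real n \<le> d x y \<Longrightarrow>
      \<exists>z\<in>carrier G. d x z + d z y = d x y \<and> d x z = real n"
    and thin: "a \<in> carrier G \<Longrightarrow> b \<in> carrier G \<Longrightarrow> c \<in> carrier G \<Longrightarrow> x \<in> carrier G \<Longrightarrow>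
      d a x + d x b = d a b \<Longrightarrow>
      \<exists>y\<in>carrier G. d x y \<le> \<delta> \<and> (d b y + d y c = d b c \<or> d c y + d y a = d c a)"
begin

text \<open>Turns a coincidence found by the pigeonhole principle into a pair of elements conjugate
  by \<open>g\<close>.\<close>

lemma conjugate_eq:
  assumes "a \<in> carrier G" "a' \<in> carrier G" "b \<in> carrier G" "b' \<in> carrier G" "g \<in> carrier G"
    and eq: "inv a \<otimes> (g \<otimes> b) = inv a' \<otimes> (g \<otimes> b')"
  shows "a' \<otimes> inv a \<otimes> g = g \<otimes> (b' \<otimes> inv b)"
proof -
  have "a' \<otimes> inv a \<otimes> g = a' \<otimes> (inv a \<otimes> (g \<otimes> b)) \<otimes> inv b"
    using assms(1-5) by (simp add: m_assoc)
  also have "\<dots> = a' \<otimes> (inv a' \<otimes> (g \<otimes> b')) \<otimes> inv b"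
    by (simp only: eq)
  also have "\<dots> = (a' \<otimes> inv a') \<otimes> (g \<otimes> (b' \<otimes> inv b))"
    using assms(1-5) by (simp only: m_assoc inv_closed m_closed)
  also have "\<dots> = g \<otimes> (b' \<otimes> inv b)"
    using assms(1-5) by (simp add: r_inv)
  finally show ?thesis .
qed

definition between :: "'a \<Rightarrow> 'a \<Rightarrow> 'a \<Rightarrow> bool" where
  "between x y z \<longleftrightarrow> d x y + d y z = d x z"

definition len :: "'a \<Rightarrow> real" where
  "len x = d \<one> x"

text \<open>The Gromov product based at \<open>\<one>\<close>. By left invariance, the product of
  \<open>x\<close> and \<open>y\<close> at a vertex \<open>g\<close> is
  \<open>gp (inv g \<otimes> x) (inv g \<otimes> y)\<close>, so one base point suffices.\<close>

definition gp :: "'a \<Rightarrow> 'a \<Rightarrow> real" where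
  "gp x y = (len x + len y - d x y) / 2"

text \<open>The error in the four-point inequality: \<open>2 * \<delta> + 1\<close> from
  \<open>near_geodesic\<close> and \<open>\<delta>\<close> from one thin triangle.\<close>

definition \<epsilon> :: real where
  "\<epsilon> = 3 * \<delta> + 1"

text \<open>Quasiconvexity in terms of vertices on geodesics. No sign is imposed on
  \<open>\<mu>\<close>, whence the absolute values in later bounds.\<close>

definition convex_within :: "real \<Rightarrow> 'a set \<Rightarrow> bool" where
  "convex_within \<mu> S \<longleftrightarrow> (\<forall>u\<in>S. \<forall>v\<in>S. \<forall>x\<in>carrier G. between u x v \<longrightarrow> (\<exists>s\<in>S. d x s \<le> \<mu>))"

lemma convex_withinD:
  "convex_within \<mu> S \<Longrightarrow> u \<in> S \<Longrightarrow> v \<in> S \<Longrightarrow> x \<in> carrier G \<Longrightarrow> between u x v \<Longrightarrow>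
    \<exists>s\<in>S. d x s \<le> \<mu>"
  unfolding convex_within_def by blast

section \<open>Elementary estimates for distances and Gromov products\<close>

lemma d_nonneg: "x \<in> carrier G \<Longrightarrow> y \<in> carrier G \<Longrightarrow> 0 \<le> d x y"
  using d_Nats[of x y] Nats_altdef1 by (auto elim!: Nats_cases)

lemma d_self [simp]: "x \<in> carrier G \<Longrightarrow> d x x = 0"
  by (simp add: d_eq_0_iff)

lemma between_commute:
  "x \<in> carrier G \<Longrightarrow> y \<in> carrier G \<Longrightarrow> z \<in> carrier G \<Longrightarrow> between x y z \<longleftrightarrow> between z y x"
  unfolding between_def by (simp add: d_commute add.commute)

lemma thinE:
  assumes "a \<in> carrier G" "b \<in> carrier G" "c \<in> carrier G" "x \<in> carrier G" "between a x b"
  obtains y where "y \<in> carrier G" "d x y \<le> \<delta>" "between a y c \<or> between c y b"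
  using thin[OF assms(1-4)] assms unfolding between_def
  by (metis d_commute add.commute)

lemma between_left:
  "g \<in> carrier G \<Longrightarrow> x \<in> carrier G \<Longrightarrow> y \<in> carrier G \<Longrightarrow> z \<in> carrier G \<Longrightarrow>
    between (g \<otimes> x) (g \<otimes> y) (g \<otimes> z) \<longleftrightarrow> between x y z"
  unfolding between_def by (simp add: d_left)

lemma between_one_left:
  assumes "g \<in> carrier G" "x \<in> carrier G" "y \<in> carrier G"
  shows "between g x (g \<otimes> y) \<longleftrightarrow> between \<one> (inv g \<otimes> x) y"
  using between_left[of "inv g" g x "g \<otimes> y"] assms by (simp add: m_assoc[symmetric])

lemma delta_nonneg: "0 \<le> \<delta>"
proof -
  obtain y where "y \<in> carrier G" "d \<one> y \<le> \<delta>"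
    by (rule thinE[of \<one> \<one> \<one> \<one>]) (auto simp: between_def)
  then show ?thesis using d_nonneg[of \<one> y] by simp
qed

lemma len_nonneg: "x \<in> carrier G \<Longrightarrow> 0 \<le> len x"
  unfolding len_def by (simp add: d_nonneg)

lemma len_one [simp]: "len \<one> = 0"
  by (simp add: len_def)

lemma d_eq_len: "x \<in> carrier G \<Longrightarrow> y \<in> carrier G \<Longrightarrow> d x y = len (inv x \<otimes> y)"
  using d_left[of "inv x" x y] by (simp add: len_def)

lemma len_inv [simp]: "x \<in> carrier G \<Longrightarrow> len (inv x) = len x"
  using d_eq_len[of x \<one>] d_commute[of x \<one>] by (simp add: len_def)

lemma gp_commute: "x \<in> carrier G \<Longrightarrow> y \<in> carrier G \<Longrightarrow> gp x y = gp y x"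
  unfolding gp_def by (simp add: d_commute)

lemma gp_le_len: "x \<in> carrier G \<Longrightarrow> y \<in> carrier G \<Longrightarrow> gp x y \<le> len x"
  unfolding gp_def len_def using d_triangle[of \<one> x y] by (simp add: d_commute)

lemma gp_one [simp]: "x \<in> carrier G \<Longrightarrow> gp x \<one> = 0"
  unfolding gp_def len_def by (simp add: d_commute)

text \<open>In the triangle \<open>\<one>\<close>, \<open>x\<close>, \<open>x \<otimes> y\<close>,
  the Gromov products at the two ends of the side from \<open>\<one>\<close> to \<open>x\<close> add
  up to its length; the left-hand side is the product at \<open>x\<close>, translated to
  \<open>\<one>\<close>.\<close>

lemma gp_inv_left:
  assumes "x \<in> carrier G" "y \<in> carrier G"
  shows "gp (inv x) y = len x - gp x (x \<otimes> y)"
proof -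
  have "d (inv x) y = len (x \<otimes> y)" using assms by (simp add: d_eq_len)
  moreover have "d x (x \<otimes> y) = len y" using assms d_left[of x \<one> y] by (simp add: len_def)
  ultimately show ?thesis using assms by (simp add: gp_def field_simps)
qed

lemma len_mult:
  assumes "x \<in> carrier G" "y \<in> carrier G"
  shows "len (x \<otimes> y) = len x + len y - 2 * gp (inv x) y"
  using assms by (simp add: gp_def d_eq_len field_simps)

lemma gp_le_of_between:
  assumes "x \<in> carrier G" "y \<in> carrier G" "m \<in> carrier G" "between x m y"
  shows "gp x y \<le> len m"
proof -
  have "len x \<le> len m + d x m" "len y \<le> len m + d m y"
    using d_triangle[of \<one> m x] d_triangle[of \<one> m y] assms by (auto simp: len_def d_commute)
  then show ?thesis using assms(4) by (simp add: gp_def between_def)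
qed

section \<open>From thin triangles to the four-point inequality\<close>

lemma between_trans:
  assumes "x \<in> carrier G" "y \<in> carrier G" "m \<in> carrier G" "n \<in> carrier G"
    "between x n m" "between x m y"
  shows "between x n y"
  using assms d_triangle[of x n y] d_triangle[of n m y] unfolding between_def by simp

text \<open>Walking back from \<open>y\<close> along a geodesic to \<open>x\<close>, one leaves the neighbourhood of the side
  from \<open>y\<close> to the base point at a vertex that is close to both sides.\<close>

lemma between_near_both:
  assumes "x \<in> carrier G" "y \<in> carrier G"
  shows "z \<in> carrier G \<Longrightarrow> between x z y \<Longrightarrow> d x z = real n \<Longrightarrow>
    q \<in> carrier G \<Longrightarrow> between \<one> q y \<Longrightarrow> d z q \<le> \<delta> + 1 \<Longrightarrow>
    \<exists>m\<in>carrier G. between x m y \<and>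
      (\<exists>p\<in>carrier G. between \<one> p x \<and> d m p \<le> \<delta>) \<and>
      (\<exists>q\<in>carrier G. between \<one> q y \<and> d m q \<le> \<delta> + 1)"
proof (induction n arbitrary: z q)
  case 0
  then have "z = x" using assms d_eq_0_iff by simp
  moreover have "between \<one> x x" using assms by (simp add: between_def)
  ultimately show ?case using 0 assms delta_nonneg by (intro bexI[of _ x]) auto
next
  case (Suc n)
  obtain p where p: "p \<in> carrier G" "d z p \<le> \<delta>" "between x p \<one> \<or> between \<one> p y"
    using thinE[of x y \<one> z] assms Suc.prems by auto
  show ?case
  proof (cases "between x p \<one>")
    case True
    then show ?thesis using p Suc.prems assms between_commute[of x p \<one>] by (intro bexI[of _ z]) auto
  next
    case False
    obtain z' where z': "z' \<in> carrier G" "between x z' z" "d x z' = real n"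
      using geodesic_point[of x z n] assms Suc.prems by (auto simp: between_def)
    \<comment> \<open>One step back moves by exactly 1, which accounts for the
      \<open>\<delta> + 1\<close> in the claim.\<close>
    have "d z' z = 1" using z' Suc.prems by (simp add: between_def)
    then have "d z' p \<le> \<delta> + 1"
      using d_triangle[of z' z p] p z' Suc.prems by simp
    moreover have "between x z' y"
      using between_trans[of x y z z'] assms z' Suc.prems by simp
    ultimately show ?thesis using Suc.IH[of z' p] z' p False by simp
  qed
qed

text \<open>A point \<open>m\<close> within \<open>\<delta>\<close> of the side to \<open>x\<close>
  has \<open>len m + d m x \<le> len x + 2 * \<delta>\<close>; being within
  \<open>\<delta> + 1\<close> of the side to \<open>y\<close> gives the analogous bound for
  \<open>y\<close>. Adding the two and halving yields the claim.\<close>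

lemma near_geodesic:
  assumes "x \<in> carrier G" "y \<in> carrier G"
  obtains m where "m \<in> carrier G" "between x m y" "len m \<le> gp x y + 2 * \<delta> + 1"
proof -
  obtain n where "d x y = real n" using d_Nats[OF assms] by (auto elim: Nats_cases)
  then obtain m p q where m: "m \<in> carrier G" "between x m y"
    "p \<in> carrier G" "between \<one> p x" "d m p \<le> \<delta>" "q \<in> carrier G" "between \<one> q y" "d m q \<le> \<delta> + 1"
    using between_near_both[of x y y n y] assms delta_nonneg by (auto simp: between_def)
  have "d m x \<le> d m p + d p x" "len m \<le> d m p + d \<one> p" "d m y \<le> d m q + d q y"
     "len m \<le> d m q + d \<one> q"
    using d_triangle[of m p x] d_triangle[of \<one> p m] d_triangle[of m q y] d_triangle[of \<one> q m] m assms
    by (auto simp: len_def d_commute)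
  then have "len m \<le> gp x y + 2 * \<delta> + 1"
    using m assms d_commute[of x m] unfolding between_def gp_def len_def by (simp add: field_simps)
  then show ?thesis using m that by blast
qed

text \<open>A point of the geodesic from \<open>x\<close> to \<open>z\<close> that nearly realizes
  \<open>gp x z\<close> is \<open>\<delta>\<close>-close to one of the other two sides, and the
  distance from \<open>\<one>\<close> to that side is at least its Gromov product.\<close>

lemma gromov_inequality:
  assumes "x \<in> carrier G" "y \<in> carrier G" "z \<in> carrier G"
  shows "min (gp x y) (gp y z) \<le> gp x z + \<epsilon>"
proof -
  obtain m where m: "m \<in> carrier G" "between x m z" "len m \<le> gp x z + 2 * \<delta> + 1"
    using near_geodesic[of x z] assms by blast
  obtain n where n: "n \<in> carrier G" "d m n \<le> \<delta>" "between x n y \<or> between y n z"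
    using thinE[of x z y m] assms m by blast
  have "min (gp x y) (gp y z) \<le> len n"
    using n gp_le_of_between[of x y n] gp_le_of_between[of y z n] assms by auto
  also have "len n \<le> len m + d m n"
    unfolding len_def using d_triangle[of \<one> m n] m n by simp
  finally show ?thesis using m n by (simp add: \<epsilon>_def)
qed

section \<open>Two quasiconvex subgroups with trivially intersecting conjugates\<close>

text \<open>By thinness \<open>y\<close> is near a geodesic from \<open>\<one>\<close> to
  \<open>g\<close>, all of whose points are within \<open>len g\<close> of \<open>g\<close>, or near
  one from \<open>g\<close> to \<open>g \<otimes> b\<close>, which is a translate of a geodesic with
  ends in \<open>B\<close>.\<close>

lemma near_coset:
  assumes B: "subgroup B G" "convex_within \<mu> B" and g: "g \<in> carrier G" and b: "b \<in> B"
    and y: "y \<in> carrier G" "between \<one> y (g \<otimes> b)"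
  shows "\<exists>b'\<in>B. d y (g \<otimes> b') \<le> \<delta> + \<bar>\<mu>\<bar> + len g"
proof -
  have bG: "b \<in> carrier G" using subgroup.mem_carrier[OF B(1) b] .
  obtain z where z: "z \<in> carrier G" "d y z \<le> \<delta>" "between \<one> z g \<or> between g z (g \<otimes> b)"
    using thinE[of \<one> "g \<otimes> b" g y] g bG y by auto
  show ?thesis
  proof (cases "between \<one> z g")
    case True
    then have "d z g \<le> len g" using z g d_nonneg[of \<one> z] by (simp add: between_def len_def)
    then have "d y (g \<otimes> \<one>) \<le> \<delta> + len g" using d_triangle[of y z g] z g y by simp
    then show ?thesis using subgroup.one_closed[OF B(1)] by (intro bexI[of _ \<one>]) auto
  next
    case False
    then have "between \<one> (inv g \<otimes> z) b" using z g bG between_one_left by auto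
    then obtain b' where b': "b' \<in> B" "d (inv g \<otimes> z) b' \<le> \<mu>"
      using convex_withinD[OF B(2) subgroup.one_closed[OF B(1)] b, of "inv g \<otimes> z"] z g by auto
    have b'G: "b' \<in> carrier G" using subgroup.mem_carrier[OF B(1) b'(1)] .
    have "d z (g \<otimes> b') \<le> \<mu>"
      using b'(2) d_left[of g "inv g \<otimes> z" b'] g z b'G by (simp add: m_assoc[symmetric])
    then have "d y (g \<otimes> b') \<le> \<delta> + \<bar>\<mu>\<bar> + len g"
      using d_triangle[of y z "g \<otimes> b'"] z g y b'G len_nonneg[OF g] by simp
    then show ?thesis using b' by blast
  qed
qed

text \<open>If the product were large, then geodesics to \<open>\<alpha>\<close> and to \<open>g \<otimes> \<beta>\<close> would fellow-travel for a
  long time, and by the pigeonhole principle two points of \<open>A\<close> near the first would differ from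
  points of \<open>g B\<close> near the second by the same short element.\<close>

lemma gp_bounded_of_trivial_conjugates:
  assumes A: "subgroup A G" "convex_within \<mu> A" and B: "subgroup B G" "convex_within \<nu> B"
    and g: "g \<in> carrier G"
    and triv: "\<And>\<alpha> \<beta>. \<alpha> \<in> A \<Longrightarrow> \<beta> \<in> B \<Longrightarrow> \<alpha> \<otimes> g = g \<otimes> \<beta> \<Longrightarrow> \<alpha> = \<one>"
  shows "\<exists>c. \<forall>\<alpha>\<in>A. \<forall>\<beta>\<in>B. gp \<alpha> (g \<otimes> \<beta>) \<le> c"
proof -
  have AG: "x \<in> carrier G" if "x \<in> A" for x using subgroup.mem_carrier[OF A(1) that] .
  have BG: "x \<in> carrier G" if "x \<in> B" for x using subgroup.mem_carrier[OF B(1) that] .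
  \<comment> \<open>The spacing of the sample points: two of them cannot be within
    \<open>\<mu>\<close> of the same element of \<open>A\<close>.\<close>
  obtain N :: nat where N: "real N > 2 * \<mu>" using reals_Archimedean2 by blast
  \<comment> \<open>The radius adds the distances from \<open>A\<close> to the first geodesic, from
    there to the second, and from there to \<open>g B\<close>.\<close>
  define F where "F = {x \<in> carrier G. d \<one> x \<le> \<mu> + \<delta> + (\<delta> + \<bar>\<nu>\<bar> + len g)}"
  have finF: "finite F" unfolding F_def by (rule finite_ball)
  \<comment> \<open>The bound leaves room for \<open>card F + 1\<close> sample points, at distances
    \<open>0, N, ..., card F * N\<close> from \<open>\<one>\<close>; the extra
    \<open>\<delta>\<close> keeps them away from the third side.\<close>
  have "gp \<alpha> (g \<otimes> \<beta>) \<le> real (card F * N) + \<delta>" if ab: "\<alpha> \<in> A" "\<beta> \<in> B" for \<alpha> \<beta>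
  proof (rule ccontr)
    assume neg: "\<not> ?thesis"
    have C: "\<alpha> \<in> carrier G" "\<beta> \<in> carrier G" using ab AG BG by auto
    have "\<exists>x a b. x \<in> carrier G \<and> d \<one> x = real (j * N) \<and> a \<in> A \<and> d x a \<le> \<mu> \<and> b \<in> B \<and>
        inv a \<otimes> (g \<otimes> b) \<in> F" if j: "j \<le> card F" for j
    proof -
      have jN: "real (j * N) \<le> real (card F * N)" using j by (metis mult_le_mono1 of_nat_mono)
      moreover have "gp \<alpha> (g \<otimes> \<beta>) \<le> d \<one> \<alpha>"
        using gp_le_len[of \<alpha> "g \<otimes> \<beta>"] C g by (simp add: len_def)
      ultimately obtain x where x: "x \<in> carrier G" "between \<one> x \<alpha>" "d \<one> x = real (j * N)"
        using geodesic_point[of \<one> \<alpha> "j * N"] neg C delta_nonneg by (auto simp: between_def)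
      obtain y where y: "y \<in> carrier G" "d x y \<le> \<delta>"
        "between \<one> y (g \<otimes> \<beta>) \<or> between (g \<otimes> \<beta>) y \<alpha>"
        using thinE[of \<one> \<alpha> "g \<otimes> \<beta>" x] x C g by auto
      have "\<not> between (g \<otimes> \<beta>) y \<alpha>"
      proof
        assume "between (g \<otimes> \<beta>) y \<alpha>"
        then have "gp \<alpha> (g \<otimes> \<beta>) \<le> len y"
          using gp_le_of_between[of "g \<otimes> \<beta>" \<alpha> y] C g y gp_commute[of \<alpha> "g \<otimes> \<beta>"] by simp
        then show False
          using d_triangle[of \<one> x y] x y neg jN by (simp add: len_def)
      qed
      then obtain b where b: "b \<in> B" "d y (g \<otimes> b) \<le> \<delta> + \<bar>\<nu>\<bar> + len g"
        using near_coset[OF B g ab(2) y(1)] y by auto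
      obtain a where a: "a \<in> A" "d x a \<le> \<mu>"
        using convex_withinD[OF A(2) subgroup.one_closed[OF A(1)] ab(1) x(1,2)] by blast
      have "d a (g \<otimes> b) \<le> d a x + d x y + d y (g \<otimes> b)"
        using d_triangle[of a x "g \<otimes> b"] d_triangle[of x y "g \<otimes> b"] AG[OF a(1)] BG[OF b(1)] g x y
        by simp
      then have "inv a \<otimes> (g \<otimes> b) \<in> F"
        using a b y x d_eq_len[of a "g \<otimes> b"] AG[OF a(1)] BG[OF b(1)] g d_commute[of a x]
        by (simp add: F_def len_def)
      then show ?thesis using x a b by blast
    qed
    then obtain X a b where xab: "\<And>j. j \<le> card F \<Longrightarrow> X j \<in> carrier G \<and> d \<one> (X j) = real (j * N) \<and>
        a j \<in> A \<and> d (X j) (a j) \<le> \<mu> \<and> b j \<in> B \<and> inv (a j) \<otimes> (g \<otimes> b j) \<in> F"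
      by metis
    have "\<not> inj_on (\<lambda>j. inv (a j) \<otimes> (g \<otimes> b j)) {..card F}"
    proof (rule pigeonhole)
      have "(\<lambda>j. inv (a j) \<otimes> (g \<otimes> b j)) ` {..card F} \<subseteq> F" using xab by auto
      from card_mono[OF finF this]
      show "card ((\<lambda>j. inv (a j) \<otimes> (g \<otimes> b j)) ` {..card F}) < card {..card F}" by simp
    qed
    then obtain i j where ij: "i \<le> card F" "j \<le> card F" "i < j"
      "inv (a i) \<otimes> (g \<otimes> b i) = inv (a j) \<otimes> (g \<otimes> b j)"
      unfolding inj_on_def by (metis atMost_iff linorder_neqE_nat)
    have c: "a i \<in> carrier G" "a j \<in> carrier G" "b i \<in> carrier G" "b j \<in> carrier G"
      using xab ij AG BG by auto
    have "a j \<otimes> inv (a i) \<otimes> g = g \<otimes> (b j \<otimes> inv (b i))"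
      using c g ij(4) by (intro conjugate_eq) auto
    moreover have "a j \<otimes> inv (a i) \<in> A" "b j \<otimes> inv (b i) \<in> B"
      using xab[OF ij(1)] xab[OF ij(2)] A(1) B(1)
      by (auto intro!: subgroup.m_closed subgroup.m_inv_closed)
    ultimately have "a j \<otimes> inv (a i) = \<one>" using triv by blast
    \<comment> \<open>Two sample points are now within \<open>\<mu>\<close> of the same element,
      against the choice of \<open>N\<close>.\<close>
    then have "a i = a j" using c inv_equality[of "a j" "inv (a i)"] by simp
    moreover have "X i \<in> carrier G" "X j \<in> carrier G" using xab ij by auto
    ultimately have "d (X i) (X j) \<le> 2 * \<mu>"
      using xab[OF ij(1)] xab[OF ij(2)] d_triangle[of "X i" "a i" "X j"] d_commute[of "X j" "a i"] c
      by simp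
    moreover have "real (j * N) \<le> real (i * N) + d (X i) (X j)"
      using xab[OF ij(1)] xab[OF ij(2)] d_triangle[of \<one> "X i" "X j"] by auto
    moreover have "real (i * N) + real N \<le> real (j * N)"
    proof -
      have "i * N + N \<le> j * N" using ij(3) mult_le_mono1[of "Suc i" j N] by simp
      then show ?thesis by (metis of_nat_add of_nat_mono)
    qed
    ultimately show False using N by linarith
  qed
  then show ?thesis by blast
qed

section \<open>Broken paths\<close>

text \<open>The corner condition says that the Gromov product of the two ends at each break point is
  at most \<open>c\<close>. As \<open>i\<close> grows, \<open>x\<close> at some stage stops being
  near the geodesic from \<open>p i\<close> to the end; there it is near the segment from
  \<open>p i\<close> to \<open>p (Suc i)\<close>, or the corner condition at
  \<open>p (Suc i)\<close> forces it close to that point.\<close>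

lemma near_broken_path:
  assumes p: "\<And>i. i \<le> n \<Longrightarrow> p i \<in> carrier G"
    and corner: "\<And>i. i \<le> n \<Longrightarrow> d (p 0) (p i) + d (p i) (p n) \<le> d (p 0) (p n) + 2 * c"
    and x: "x \<in> carrier G" "between (p 0) x (p n)"
  shows "(\<exists>i\<le>n. d x (p i) \<le> 2 * c + 4 * \<delta>) \<or>
    (\<exists>i<n. \<exists>y\<in>carrier G. between (p i) y (p (Suc i)) \<and> d x y \<le> 2 * \<delta>)"
proof -
  define near where "near i \<longleftrightarrow> (\<exists>y\<in>carrier G. between (p i) y (p n) \<and> d x y \<le> \<delta>)" for i
  have p0n: "p 0 \<in> carrier G" "p n \<in> carrier G" using p by auto
  have c0: "0 \<le> c" using corner[of 0] p0n by simp
  have near0: "near 0" using x delta_nonneg by (auto simp: near_def intro!: bexI[of _ x])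
  show ?thesis
  proof (cases "near n")
    case True
    then obtain y where "y \<in> carrier G" "between (p n) y (p n)" "d x y \<le> \<delta>"
      by (auto simp: near_def)
    moreover from this have "y = p n"
      using p0n d_nonneg[of y "p n"] d_commute[of y "p n"] by (simp add: between_def d_eq_0_iff)
    ultimately show ?thesis using c0 delta_nonneg by (intro disjI1 exI[of _ n]) auto
  next
    case False
    have "\<exists>i<n. near i \<and> \<not> near (Suc i)"
    proof (rule ccontr)
      assume neg: "\<not> ?thesis"
      have "i \<le> n \<Longrightarrow> near i" for i by (induction i) (use near0 neg in auto)
      then show False using False by simp
    qed
    then obtain i where i: "i < n" "near i" "\<not> near (Suc i)" by blast
    have P: "p i \<in> carrier G" "p (Suc i) \<in> carrier G" using p i by auto
    \<comment> \<open>The other side of this triangle is excluded by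
      \<open>\<not> near (Suc i)\<close>.\<close>
    obtain z where z: "z \<in> carrier G" "d x z \<le> \<delta>" "between (p 0) z (p (Suc i))"
      using thinE[of "p 0" "p n" "p (Suc i)" x] p0n P x i by (auto simp: near_def)
    obtain y where y: "y \<in> carrier G" "between (p i) y (p n)" "d x y \<le> \<delta>"
      using i by (auto simp: near_def)
    obtain w where w: "w \<in> carrier G" "d y w \<le> \<delta>"
      "between (p i) w (p (Suc i)) \<or> between (p (Suc i)) w (p n)"
      using thinE[of "p i" "p n" "p (Suc i)" y] p0n P y by auto
    have xw: "d x w \<le> 2 * \<delta>" using d_triangle[of x y w] x y w by simp
    show ?thesis
    proof (cases "between (p i) w (p (Suc i))")
      case True
      then show ?thesis using i w xw by blast
    next
      case False
      \<comment> \<open>The points \<open>z\<close> and \<open>w\<close> lie before and after the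
        corner \<open>p (Suc i)\<close>. Being close to each other, they give a shortcut past it,
        which would violate the corner condition if \<open>z\<close> were far from the
        corner.\<close>
      have "d z w \<le> 3 * \<delta>" using d_triangle[of z x w] d_commute[of x z] x z w xw by simp
      moreover have "d (p 0) (p n) \<le> d (p 0) z + d z w + d w (p n)"
        using d_triangle[of "p 0" z "p n"] d_triangle[of z w "p n"] z w p0n by simp
      moreover have "d (p 0) (p (Suc i)) + d (p (Suc i)) (p n) \<le> d (p 0) (p n) + 2 * c"
        using corner i by simp
      ultimately have "d z (p (Suc i)) \<le> 2 * c + 3 * \<delta>"
        using z w False d_nonneg[of "p (Suc i)" w] P by (simp add: between_def)
      then have "d x (p (Suc i)) \<le> 2 * c + 4 * \<delta>"
        using d_triangle[of x z "p (Suc i)"] x z P by simp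
      then show ?thesis using i Suc_leI by blast
    qed
  qed
qed

end

section \<open>Reduced words\<close>

text \<open>Here \<open>L\<close> stands for the finite index subgroup. In \<open>gp_L_KL\<close>
  the case \<open>k = \<one>\<close> must be excluded, since \<open>gp h h = len h\<close>. The
  bound in \<open>long\<close> is what \<open>gp_L_word\<close> consumes: up to
  \<open>3 * b + 2 * \<epsilon>\<close> of the length of a letter is lost, and more than
  \<open>b + \<epsilon>\<close> must remain.\<close>

locale free_factors = hyperbolic_group +
  fixes L K :: "'a set" and b :: real
  assumes L: "subgroup L G" and K: "subgroup K G"
    and gp_L_K: "h \<in> L \<Longrightarrow> k \<in> K \<Longrightarrow> gp h k \<le> b"
    and gp_L_KL: "h \<in> L \<Longrightarrow> h' \<in> L \<Longrightarrow> k \<in> K \<Longrightarrow> k \<noteq> \<one> \<Longrightarrow> gp h (k \<otimes> h') \<le> b"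
    and long: "h \<in> L \<Longrightarrow> h \<noteq> \<one> \<Longrightarrow> 4 * b + 3 * \<epsilon> < len h"
begin

abbreviation "LG \<equiv> G\<lparr>carrier := L\<rparr>"
abbreviation "KG \<equiv> G\<lparr>carrier := K\<rparr>"
abbreviation "W \<equiv> free_product_words LG KG"
abbreviation "M \<equiv> generate G (L \<union> K)"

definition ev :: "('a + 'a) list \<Rightarrow> 'a" where
  "ev = word_eval G id id"

definition reduced :: "('a + 'a) list \<Rightarrow> bool" where
  "reduced w \<longleftrightarrow> set w \<subseteq> Inl ` (L - {\<one>}) \<union> Inr ` (K - {\<one>}) \<and>
    successively (\<lambda>s t. isl s \<noteq> isl t) w"

definition inv_word :: "('a + 'a) list \<Rightarrow> ('a + 'a) list" where
  "inv_word w = rev (map (map_sum (m_inv G) (m_inv G)) w)"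

lemma L_carrier: "h \<in> L \<Longrightarrow> h \<in> carrier G"
  using subgroup.mem_carrier[OF L] .

lemma K_carrier: "k \<in> K \<Longrightarrow> k \<in> carrier G"
  using subgroup.mem_carrier[OF K] .

lemma b_nonneg: "0 \<le> b"
  using gp_L_K[OF subgroup.one_closed[OF L] subgroup.one_closed[OF K]] by simp

lemma eps_pos: "0 < \<epsilon>"
  using delta_nonneg by (simp add: \<epsilon>_def)

lemma group_LG: "group LG" and group_KG: "group KG"
  using subgroup_imp_group L K by auto

lemma id_hom_LG: "id \<in> hom LG G" and id_hom_KG: "id \<in> hom KG G"
  using L_carrier K_carrier by (auto simp: hom_def)

lemma ev_simps [simp]:
  "ev [] = \<one>" "ev (Inl h # w) = h \<otimes> ev w" "ev (Inr k # w) = k \<otimes> ev w"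
  by (simp_all add: ev_def)

lemmas ev_closed = word_eval_closed[OF group_LG group_KG is_group id_hom_LG id_hom_KG,
    folded ev_def]
lemmas ev_append = word_eval_append[OF group_LG group_KG is_group id_hom_LG id_hom_KG,
    folded ev_def]

lemma words_iff: "w \<in> W \<longleftrightarrow> set w \<subseteq> Inl ` L \<union> Inr ` K"
  by (auto simp: free_product_words_def)

lemma reduced_words: "reduced w \<Longrightarrow> w \<in> W"
  unfolding reduced_def words_iff by blast

lemma reduced_ev_closed: "reduced w \<Longrightarrow> ev w \<in> carrier G"
  using reduced_words ev_closed by blast

lemma reduced_append:
  "reduced (u @ v) \<longleftrightarrow> reduced u \<and> reduced v \<and>
    (u = [] \<or> v = [] \<or> isl (last u) \<noteq> isl (hd v))"
  by (auto simp: reduced_def successively_append_iff)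

lemma reduced_Cons:
  "reduced (s # w) \<longleftrightarrow> s \<in> Inl ` (L - {\<one>}) \<union> Inr ` (K - {\<one>}) \<and> reduced w \<and>
    (w = [] \<or> isl s \<noteq> isl (hd w))"
  by (auto simp: reduced_def successively_Cons)

lemma reduced_Nil [simp]: "reduced []"
  by (simp add: reduced_def)

lemma inv_word_simps [simp]:
  "inv_word [] = []" "inv_word (s # w) = inv_word w @ [map_sum (m_inv G) (m_inv G) s]"
  by (simp_all add: inv_word_def)

lemma inv_word_Nil_iff [simp]: "inv_word w = [] \<longleftrightarrow> w = []"
  by (simp add: inv_word_def)

lemma inv_word_append: "inv_word (u @ v) = inv_word v @ inv_word u"
  by (simp add: inv_word_def)

lemma hd_inv_word: "w \<noteq> [] \<Longrightarrow> isl (hd (inv_word w)) = isl (last w)"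
  by (cases w rule: rev_cases) (auto simp: inv_word_append map_sum_def split: sum.split)

lemma last_inv_word: "w \<noteq> [] \<Longrightarrow> isl (last (inv_word w)) = isl (hd w)"
  by (cases w) (auto simp: map_sum_def split: sum.split)

lemma reduced_inv_word: "reduced w \<Longrightarrow> reduced (inv_word w)"
proof (induction w)
  case (Cons s w)
  then have "reduced (inv_word w)" by (simp add: reduced_Cons)
  moreover have "reduced [map_sum (m_inv G) (m_inv G) s]"
    using Cons.prems L_carrier K_carrier subgroup.m_inv_closed[OF L] subgroup.m_inv_closed[OF K]
    by (auto simp: reduced_Cons inv_eq_1_iff)
  moreover have "isl (map_sum (m_inv G) (m_inv G) s) = isl s" by (cases s) auto
  ultimately show ?case using Cons.prems last_inv_word[of w]
    by (auto simp: reduced_append reduced_Cons)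
qed simp

lemma ev_inv_word: "reduced w \<Longrightarrow> ev (inv_word w) = inv (ev w)"
proof (induction w)
  case (Cons s w)
  then have r: "reduced w" "reduced [s]" by (auto simp: reduced_Cons)
  have r': "reduced (inv_word w)" "reduced (inv_word [s])" using r reduced_inv_word by blast+
  have s: "ev (inv_word [s]) = inv (ev [s])" "ev [s] \<in> carrier G"
    using r(2) L_carrier K_carrier by (auto simp: reduced_Cons)
  have "ev (inv_word (s # w)) = ev (inv_word w) \<otimes> ev (inv_word [s])"
    using ev_append[of "inv_word w" "inv_word [s]"] r' reduced_words by simp
  also have "\<dots> = inv (ev w) \<otimes> inv (ev [s])" using Cons.IH r s by simp
  also have "\<dots> = inv (ev [s] \<otimes> ev w)" using s r reduced_ev_closed by (simp add: inv_mult_group)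
  also have "ev [s] \<otimes> ev w = ev (s # w)"
    using ev_append[of "[s]" w] r reduced_words by simp
  finally show ?case .
qed simp

section \<open>Gromov products at the break points of a reduced word\<close>

text \<open>The word is read two letters at a time, as \<open>k\<close>, \<open>l\<close> and a
  rest. The long letter \<open>l\<close> makes the whole word follow \<open>k \<otimes> l\<close>
  far enough that the hypothesis on \<open>k \<otimes> l\<close> decides the bound. It enters afresh
  in each step, so the errors do not accumulate.\<close>

lemma gp_L_word:
  "reduced w \<Longrightarrow> w \<noteq> [] \<Longrightarrow> \<not> isl (hd w) \<Longrightarrow> h \<in> L \<Longrightarrow> gp h (ev w) \<le> b + \<epsilon>"
proof (induction w arbitrary: h rule: induct_list012)
  case (2 s)
  then obtain k where "s = Inr k" "k \<in> K" by (auto simp: reduced_Cons)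
  then show ?case using gp_L_K[OF 2(4), of k] K_carrier eps_pos by simp
next
  case (3 s t w)
  then obtain k where s: "s = Inr k" "k \<in> K" "k \<noteq> \<one>" by (auto simp: reduced_Cons)
  then obtain l where t: "t = Inl l" "l \<in> L" "l \<noteq> \<one>" using 3 by (auto simp: reduced_Cons)
  have r: "reduced w" using 3 by (simp add: reduced_Cons)
  have C: "k \<in> carrier G" "l \<in> carrier G" "h \<in> carrier G" "ev w \<in> carrier G"
    using s t 3 r L_carrier K_carrier reduced_ev_closed by auto
  have ll: "4 * b + 3 * \<epsilon> < len l" using long t by simp
  show ?case
  proof (cases "w = []")
    case True
    then show ?thesis using s t gp_L_KL[OF 3(6) t(2) s(2,3)] C eps_pos by simp
  next
    case False
    have il: "inv l \<in> L" and ik: "inv k \<in> K"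
      using s t subgroup.m_inv_closed[OF L] subgroup.m_inv_closed[OF K] by auto
    define x where "x = k \<otimes> l"
    have x: "x \<in> carrier G" "inv x = inv l \<otimes> inv k"
      using C by (auto simp: x_def inv_mult_group)
    \<comment> \<open>The induction hypothesis controls the turn after \<open>l\<close>. Since
      \<open>inv x\<close> follows \<open>inv l\<close> for a long time, the turn from
      \<open>x\<close> into \<open>ev w\<close> is controlled as well.\<close>
    have "gp (inv l) (ev w) \<le> b + \<epsilon>"
      using 3(1)[OF r False _ il] 3(3) False t by (auto simp: reduced_Cons)
    moreover have "gp (inv l) (inv x) = len l - gp l (inv k)"
      using gp_inv_left[of l "inv x"] C x(2) by (simp add: m_assoc[symmetric])
    moreover have "gp l (inv k) \<le> b" using gp_L_K t ik by simp
    moreover have "min (gp (inv l) (inv x)) (gp (inv x) (ev w)) \<le> gp (inv l) (ev w) + \<epsilon>"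
      using gromov_inequality[of "inv l" "inv x" "ev w"] C x by simp
    ultimately have "gp (inv x) (ev w) \<le> b + 2 * \<epsilon>" using ll b_nonneg eps_pos by (simp add: min_le_iff_disj)
    moreover have "gp (inv x) (ev w) = len x - gp x (x \<otimes> ev w)" using gp_inv_left[OF x(1) C(4)] .
    moreover have "len x = len k + len l - 2 * gp (inv k) l" unfolding x_def using len_mult C by simp
    moreover have "gp (inv k) l \<le> b" using gp_L_K t ik gp_commute[of "inv k" l] C by simp
    \<comment> \<open>The length of \<open>x\<close> is at least \<open>len l - 2 * b\<close>, and
      the turn costs at most \<open>b + 2 * \<epsilon>\<close>. The length of \<open>k\<close> only
      helps, so short letters from \<open>K\<close> do no harm.\<close>
    ultimately have "b + \<epsilon> < gp x (x \<otimes> ev w)"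
      using ll b_nonneg eps_pos len_nonneg[of k] C by simp
    moreover have "min (gp h (x \<otimes> ev w)) (gp (x \<otimes> ev w) x) \<le> gp h x + \<epsilon>"
      using gromov_inequality[of h "x \<otimes> ev w" x] C x by simp
    moreover have "gp h x \<le> b" unfolding x_def using gp_L_KL[OF 3(6) t(2) s(2,3)] .
    ultimately have "gp h (x \<otimes> ev w) \<le> b + \<epsilon>"
      using gp_commute[of x "x \<otimes> ev w"] C x by (simp add: min_le_iff_disj)
    then show ?thesis using s t C by (simp add: x_def m_assoc)
  qed
qed simp

text \<open>Write \<open>h\<close> for the last letter of \<open>u\<close>. Seen from
  \<open>inv h\<close>, the path back along \<open>u\<close> follows \<open>h\<close> almost
  entirely and \<open>ev v\<close> departs early, both by \<open>gp_L_word\<close>, applied to the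
  inverse of the rest of \<open>u\<close> and to \<open>v\<close>. The four-point inequality then
  separates the two paths.\<close>

lemma gp_corner_L:
  assumes "reduced (u @ v)" "u \<noteq> []" "v \<noteq> []" "isl (last u)"
  shows "gp (inv (ev u)) (ev v) \<le> b + 2 * \<epsilon>"
proof -
  obtain u' h where u: "u = u' @ [Inl h]" "h \<in> L" "h \<noteq> \<one>"
    using assms by (cases u rule: rev_cases) (auto simp: reduced_append reduced_Cons)
  have r: "reduced u'" "reduced u" "reduced v" "\<not> isl (hd v)"
    using assms u reduced_append[of u v] reduced_append[of u' "[Inl h]"] by auto
  have C: "h \<in> carrier G" "ev u' \<in> carrier G" "ev v \<in> carrier G"
    using L_carrier u r reduced_ev_closed by auto
  have ih: "inv h \<in> L" using u subgroup.m_inv_closed[OF L] by simp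
  have evu: "ev u = ev u' \<otimes> h"
    using ev_append[of u' "[Inl h]"] u r(1) C reduced_words by (simp add: words_iff)
  have "gp (inv h) (inv (ev u)) = len h - gp h (inv (ev u'))"
    using gp_inv_left[of h "inv (ev u)"] C evu by (simp add: inv_mult_group m_assoc[symmetric])
  moreover have "gp h (inv (ev u')) \<le> b + \<epsilon>"
  proof (cases "u' = []")
    case True
    then show ?thesis using C b_nonneg eps_pos by simp
  next
    case False
    then have "\<not> isl (hd (inv_word u'))"
      using assms u hd_inv_word by (simp add: reduced_append)
    then show ?thesis
      using gp_L_word[OF reduced_inv_word[OF r(1)] _ _ u(2)] False ev_inv_word[OF r(1)] by simp
  qed
  moreover have "gp (inv h) (ev v) \<le> b + \<epsilon>"
    using gp_L_word[OF r(3) assms(3) r(4) ih] .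
  moreover have "min (gp (inv h) (inv (ev u))) (gp (inv (ev u)) (ev v)) \<le> gp (inv h) (ev v) + \<epsilon>"
    using gromov_inequality[of "inv h" "inv (ev u)" "ev v"] C evu by simp
  ultimately show ?thesis
    using long[OF u(2,3)] b_nonneg eps_pos by (simp add: min_le_iff_disj)
qed

text \<open>At a break point after a letter from \<open>K\<close> the next letter is from
  \<open>L\<close>; inverting the whole word puts that letter in front of the corner.\<close>

lemma gp_corner:
  assumes "reduced (u @ v)"
  shows "gp (inv (ev u)) (ev v) \<le> b + 2 * \<epsilon>"
proof -
  have r: "reduced u" "reduced v" "reduced (inv_word u)" "reduced (inv_word v)"
    using assms reduced_inv_word by (auto simp: reduced_append)
  have C: "ev u \<in> carrier G" "ev v \<in> carrier G" using r reduced_ev_closed by auto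
  consider "u = [] \<or> v = []" | "u \<noteq> []" "v \<noteq> []" "isl (last u)"
    | "u \<noteq> []" "v \<noteq> []" "\<not> isl (last u)" by blast
  then show ?thesis
  proof cases
    case 1
    then show ?thesis using C gp_commute[of \<one> "ev v"] b_nonneg eps_pos by auto
  next
    case 2
    then show ?thesis using gp_corner_L assms by blast
  next
    case 3
    then have "isl (last (inv_word v))" using assms last_inv_word by (auto simp: reduced_append)
    moreover have "reduced (inv_word v @ inv_word u)"
      using reduced_inv_word[OF assms] by (simp add: inv_word_append)
    ultimately have "gp (inv (ev (inv_word v))) (ev (inv_word u)) \<le> b + 2 * \<epsilon>"
      using gp_corner_L 3 by simp
    then show ?thesis using r C ev_inv_word gp_commute[of "inv (ev u)" "ev v"] by simp
  qed
qed

text \<open>Stronger and better suited to both cases: a reduced word beginning with \<open>h\<close>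
  from \<open>L\<close> has no value in \<open>K\<close>. Otherwise the Gromov products at both ends
  of \<open>h\<close> would be small, while they add up to \<open>len h\<close>. If a word of value
  \<open>\<one>\<close> begins with \<open>k\<close> from \<open>K\<close>, its rest has the value
  \<open>inv k\<close>.\<close>

lemma reduced_ev_neq_one:
  assumes "reduced w" "w \<noteq> []"
  shows "ev w \<noteq> \<one>"
proof
  assume one: "ev w = \<one>"
  have *: False if r: "reduced (Inl h # v)" and e: "h \<otimes> ev v \<in> K" for h v
  proof -
    have h: "h \<in> L" "h \<noteq> \<one>" "reduced v" using r by (auto simp: reduced_Cons)
    have C: "h \<in> carrier G" "ev v \<in> carrier G"
      using L_carrier h reduced_ev_closed by auto
    have "gp (inv h) (ev v) \<le> b + \<epsilon>"
    proof (cases "v = []")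
      case True
      then show ?thesis using C b_nonneg eps_pos by simp
    next
      case False
      then show ?thesis
        using gp_L_word[OF h(3), of "inv h"] r subgroup.m_inv_closed[OF L h(1)]
        by (auto simp: reduced_Cons)
    qed
    moreover have "gp (inv h) (ev v) = len h - gp h (h \<otimes> ev v)" using gp_inv_left C by simp
    moreover have "gp h (h \<otimes> ev v) \<le> b" using gp_L_K h e by blast
    ultimately show False using long[OF h(1,2)] b_nonneg eps_pos by simp
  qed
  obtain s v where w: "w = s # v" using assms by (cases w) auto
  show False
  proof (cases s)
    case (Inl h)
    then show False using *[of h v] one w assms subgroup.one_closed[OF K] by simp
  next
    case (Inr k)
    then have k: "k \<in> K" "k \<noteq> \<one>" "reduced v" using assms w by (auto simp: reduced_Cons)
    have C: "k \<in> carrier G" "ev v \<in> carrier G" using K_carrier k reduced_ev_closed by auto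
    have ev: "ev v = inv k"
      using one w Inr C inv_equality[of "k" "ev v"] inv_equality[of "ev v" k] by (simp add: inv_comm)
    show False
    proof (cases v)
      case Nil
      then show False using ev k C inv_eq_1_iff[of k] by simp
    next
      case (Cons t v')
      then obtain h where "t = Inl h" using assms w Inr by (cases t) (auto simp: reduced_Cons)
      then show False using *[of h v'] Cons ev k subgroup.m_inv_closed[OF K k(1)] by simp
    qed
  qed
qed

text \<open>Prepending a letter to a reduced word needs at most one merger with its first letter:
  the merged letter is either trivial and dropped, or lies in the same factor as the letter it
  replaces and so still alternates with the rest.\<close>

lemma reduced_representative:
  "w \<in> W \<Longrightarrow> \<exists>v. reduced v \<and> (w, v) \<in> free_product_rel LG KG"
proof (induction w)
  case Nil
  then show ?case by (intro exI[of _ "[]"]) (auto intro: free_product_rel.refl)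
next
  case (Cons s w)
  then have s: "[s] \<in> W" and w: "w \<in> W" by (auto simp: words_iff)
  obtain v where v: "reduced v" "(w, v) \<in> free_product_rel LG KG"
    using Cons.IH w by blast
  have vW: "v \<in> W" using v reduced_words by blast
  have step: "(s # w, v') \<in> free_product_rel LG KG"
    if "([s] @ v, v') \<in> free_product_rel LG KG" for v'
    using free_product_rel.trans[OF free_product_rel.append[OF free_product_rel.refl[OF s] v(2)] that]
    by simp
  show ?case
  proof (cases "s = Inl \<one> \<or> s = Inr \<one>")
    case True
    then have "([s], []) \<in> free_product_rel LG KG"
      using free_product_rel.one_left[of LG KG] free_product_rel.one_right[of KG LG] by auto
    then have "([s] @ v, v) \<in> free_product_rel LG KG"
      using free_product_rel.append[OF _ free_product_rel.refl[OF vW]] by force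
    then show ?thesis using step v by blast
  next
    case s1: False
    show ?thesis
    proof (cases "v = [] \<or> isl s \<noteq> isl (hd v)")
      case True
      then have "reduced (s # v)" using s s1 v by (auto simp: reduced_Cons words_iff)
      moreover have "([s] @ v, s # v) \<in> free_product_rel LG KG"
        using s vW by (auto intro!: free_product_rel.refl simp: words_iff)
      ultimately show ?thesis using step by blast
    next
      case False
      then obtain t v' where t: "v = t # v'" "isl s = isl t" by (cases v) auto
      have v': "reduced v'" "v' \<in> W" "v' = [] \<or> isl t \<noteq> isl (hd v')"
        using v t reduced_words by (auto simp: reduced_Cons)
      obtain r where r: "([s, t], [r]) \<in> free_product_rel LG KG" "isl r = isl t"
        "r \<in> Inl ` L \<union> Inr ` K"
      proof (cases s)
        case (Inl x)
        then obtain y where "t = Inl y" using t by (cases t) auto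
        moreover have "x \<in> L" "y \<in> L" using Inl s calculation vW t by (auto simp: words_iff)
        ultimately show thesis
          using that[of "Inl (x \<otimes> y)"] Inl free_product_rel.mult_left[of x LG y KG]
            subgroup.m_closed[OF L] by simp
      next
        case (Inr x)
        then obtain y where "t = Inr y" using t by (cases t) auto
        moreover have "x \<in> K" "y \<in> K" using Inr s calculation vW t by (auto simp: words_iff)
        ultimately show thesis
          using that[of "Inr (x \<otimes> y)"] Inr free_product_rel.mult_right[of x KG y LG]
            subgroup.m_closed[OF K] by simp
      qed
      have st: "([s] @ v, [r] @ v') \<in> free_product_rel LG KG"
        using free_product_rel.append[OF r(1) free_product_rel.refl[OF v'(2)]] t by simp
      show ?thesis
      proof (cases "r = Inl \<one> \<or> r = Inr \<one>")
        case True
        then have "([r], []) \<in> free_product_rel LG KG"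
          using free_product_rel.one_left[of LG KG] free_product_rel.one_right[of KG LG] by auto
        then have "([r] @ v', v') \<in> free_product_rel LG KG"
          using free_product_rel.append[OF _ free_product_rel.refl[OF v'(2)]] by force
        then show ?thesis using step free_product_rel.trans[OF st] v' by blast
      next
        case False
        then have "reduced ([r] @ v')" using r v' by (auto simp: reduced_Cons)
        then show ?thesis using step[OF st] by blast
      qed
    qed
  qed
qed

section \<open>The subgroup generated by the two factors\<close>

lemma subgroup_M: "subgroup M G"
  using generate_is_subgroup L_carrier K_carrier by blast

lemma ev_in_M: "w \<in> W \<Longrightarrow> ev w \<in> M"
proof (induction w)
  case (Cons s w)
  then show ?case
    by (cases s) (auto simp: words_iff intro: generate.eng generate.incl)
qed (simp add: generate.one)

lemma M_word: "x \<in> M \<Longrightarrow> \<exists>w\<in>W. ev w = x"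
proof (induction rule: generate.induct)
  case one
  then show ?case by (intro bexI[of _ "[]"]) auto
next
  case (incl h)
  then show ?case
  proof
    assume "h \<in> L"
    then show ?thesis using L_carrier by (intro bexI[of _ "[Inl h]"]) (auto simp: words_iff)
  next
    assume "h \<in> K"
    then show ?thesis using K_carrier by (intro bexI[of _ "[Inr h]"]) (auto simp: words_iff)
  qed
next
  case (inv h)
  then show ?case
  proof
    assume "h \<in> L"
    then show ?thesis using L_carrier subgroup.m_inv_closed[OF L]
      by (intro bexI[of _ "[Inl (inv h)]"]) (auto simp: words_iff)
  next
    assume "h \<in> K"
    then show ?thesis using K_carrier subgroup.m_inv_closed[OF K]
      by (intro bexI[of _ "[Inr (inv h)]"]) (auto simp: words_iff)
  qed
next
  case (eng x y)
  then obtain u v where "u \<in> W" "v \<in> W" "ev u = x" "ev v = y" by blast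
  then show ?case using ev_append[of u v] free_product_words_append by blast
qed

lemmas ev_cong = word_eval_cong[OF group_LG group_KG is_group id_hom_LG id_hom_KG,
    folded ev_def]

lemma M_reduced_word: "x \<in> M \<Longrightarrow> \<exists>w. reduced w \<and> ev w = x"
  using M_word reduced_representative ev_cong by metis

text \<open>The image is \<open>M\<close> because every element of \<open>M\<close> is the value of
  a word. A class in the kernel contains a reduced word of value \<open>\<one>\<close>, which is
  empty.\<close>

lemma internal_free_product: "is_internal_free_product G L K"
proof -
  let ?P = "free_product LG KG" and ?MG = "G\<lparr>carrier := M\<rparr>" and ?f = "free_product_lift G id id"
  interpret P: group ?P by (rule group_free_product[OF group_LG group_KG])
  note lift = free_product_lift_class[OF group_LG group_KG is_group id_hom_LG id_hom_KG,
      folded ev_def]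
  interpret f: group_hom ?P G ?f
    by unfold_locales (rule free_product_lift_hom[OF group_LG group_KG is_group id_hom_LG id_hom_KG])
  have img: "?f ` carrier ?P = M"
  proof
    show "?f ` carrier ?P \<subseteq> M"
      by (auto elim!: free_product_carrierE simp: lift ev_in_M)
    show "M \<subseteq> ?f ` carrier ?P"
    proof
      fix x
      assume "x \<in> M"
      then obtain w where w: "w \<in> W" "ev w = x" using M_word by blast
      show "x \<in> ?f ` carrier ?P"
        using lift[OF w(1)] w free_product_class_carrier[OF w(1)] by (intro image_eqI) auto
    qed
  qed
  have "U = \<one>\<^bsub>?P\<^esub>" if U: "U \<in> carrier ?P" "?f U = \<one>" for U
  proof -
    obtain w where w: "w \<in> W" "U = free_product_rel LG KG `` {w}"
      using U by (auto elim: free_product_carrierE)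
    obtain v where v: "reduced v" "(w, v) \<in> free_product_rel LG KG"
      using reduced_representative w by blast
    have "ev v = \<one>" using U w lift ev_cong[OF v(2)] by simp
    then have "v = []" using reduced_ev_neq_one v by blast
    then show ?thesis
      using w v equiv_class_eq[OF equiv_free_product_rel[OF group_LG group_KG] v(2)]
      by (simp add: free_product_one)
  qed
  then have "inj_on ?f (carrier ?P)"
    by (intro f.inj_on_one_iff[THEN iffD2]) blast
  then show ?thesis
    unfolding is_internal_free_product_def iso_def bij_betw_def using img f.homh
    by (auto simp: hom_def)
qed

text \<open>The prefixes of a reduced word form a broken path in \<open>M\<close> whose segments are
  translates of geodesics with ends in \<open>L\<close> or in \<open>K\<close>. By left translation
  it suffices to treat geodesics starting at \<open>\<one>\<close>.\<close>

lemma convex_within_M: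
  assumes "convex_within \<mu> L" "convex_within \<nu> K"
  shows "\<exists>\<rho>. convex_within \<rho> M"
proof -
  define c where "c = b + 2 * \<epsilon>"
  define \<rho> where "\<rho> = 2 * c + 4 * \<delta> + \<bar>\<mu>\<bar> + \<bar>\<nu>\<bar>"
  have c0: "0 \<le> c" using b_nonneg eps_pos by (simp add: c_def)
  have MC: "x \<in> carrier G" if "x \<in> M" for x using subgroup.mem_carrier[OF subgroup_M that] .
  have start: "\<exists>s\<in>M. d x s \<le> \<rho>" if y: "y \<in> M" and x: "x \<in> carrier G" "between \<one> x y" for x y
  proof -
    obtain w where w: "reduced w" "ev w = y" using M_reduced_word y by blast
    define p where "p i = ev (take i w)" for i
    have rt: "reduced (take i w)" "reduced (drop i w)" for i
      using w(1) reduced_append[of "take i w" "drop i w"] by auto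
    have C: "p i \<in> carrier G" "ev (drop i w) \<in> carrier G" for i
      using rt reduced_ev_closed by (auto simp: p_def)
    have y_split: "y = p i \<otimes> ev (drop i w)" for i
      using ev_append[of "take i w" "drop i w"] rt reduced_words w by (simp add: p_def)
    have pM: "p i \<in> M" for i using ev_in_M rt reduced_words by (simp add: p_def)
    have p0n: "p 0 = \<one>" "p (length w) = y" using w by (auto simp: p_def)
    \<comment> \<open>The excess of the detour through \<open>p i\<close> is twice the Gromov
      product at \<open>p i\<close>, which \<open>gp_corner\<close> bounds.\<close>
    have "d (p 0) (p i) + d (p i) (p (length w)) \<le> d (p 0) (p (length w)) + 2 * c" for i
    proof -
      have "d (p i) y = len (ev (drop i w))"
        using d_left[of "p i" \<one> "ev (drop i w)"] C y_split[of i] by (simp add: len_def)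
      moreover have "len y = len (p i) + len (ev (drop i w)) - 2 * gp (inv (p i)) (ev (drop i w))"
        using len_mult C y_split[of i] by metis
      moreover have "gp (inv (p i)) (ev (drop i w)) \<le> c"
        unfolding c_def p_def using gp_corner[of "take i w" "drop i w"] w by simp
      ultimately show ?thesis using p0n by (simp add: len_def)
    qed
    from near_broken_path[OF C(1) this, where x = x] x p0n
    consider i where "d x (p i) \<le> 2 * c + 4 * \<delta>"
      | i z where "i < length w" "z \<in> carrier G" "between (p i) z (p (Suc i))" "d x z \<le> 2 * \<delta>"
      by auto
    then show ?thesis
    proof cases
      case 1
      then show ?thesis using pM by (intro bexI[of _ "p i"]) (auto simp: \<rho>_def)
    next
      case 2
      define g where "g = ev [w ! i]"
      have wi: "w ! i \<in> set w" using 2 by simp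
      have g: "(g \<in> L \<or> g \<in> K)"
        using wi w(1) L_carrier K_carrier by (auto simp: g_def reduced_def)
      have gC: "g \<in> carrier G" using g L_carrier K_carrier by blast
      have "p (Suc i) = p i \<otimes> g"
        unfolding p_def g_def take_Suc_conv_app_nth[OF 2(1)]
        using wi rt(1) reduced_words w(1) by (intro ev_append) (auto simp: words_iff)
      then have btw: "between \<one> (inv (p i) \<otimes> z) g"
        using 2 between_one_left[of "p i" z g] C gC by simp
      obtain s where s: "s \<in> M" "d (inv (p i) \<otimes> z) s \<le> \<bar>\<mu>\<bar> + \<bar>\<nu>\<bar>"
        using g
      proof
        assume gL: "g \<in> L"
        obtain s where "s \<in> L" "d (inv (p i) \<otimes> z) s \<le> \<mu>"
          using convex_withinD[OF assms(1) subgroup.one_closed[OF L] gL _ btw] 2 C by auto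
        with gL show thesis using that[of s] generate.incl[of s "L \<union> K" G] by fastforce
      next
        assume gK: "g \<in> K"
        obtain s where "s \<in> K" "d (inv (p i) \<otimes> z) s \<le> \<nu>"
          using convex_withinD[OF assms(2) subgroup.one_closed[OF K] gK _ btw] 2 C by auto
        with gK show thesis using that[of s] generate.incl[of s "L \<union> K" G] by fastforce
      qed
      have "d z (p i \<otimes> s) = d (inv (p i) \<otimes> z) s"
        using d_left[of "p i" "inv (p i) \<otimes> z" s] C 2 MC[OF s(1)] by (simp add: m_assoc[symmetric])
      then have "d x (p i \<otimes> s) \<le> \<rho>"
        using d_triangle[of x z "p i \<otimes> s"] x 2 C MC[OF s(1)] s(2) c0 delta_nonneg
        by (simp add: \<rho>_def)
      then show ?thesis using subgroup.m_closed[OF subgroup_M pM s(1)] by blast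
    qed
  qed
  have "convex_within \<rho> M"
    unfolding convex_within_def
  proof (intro ballI impI)
    fix u v x
    assume uvx: "u \<in> M" "v \<in> M" "x \<in> carrier G" "between u x v"
    have "v = u \<otimes> (inv u \<otimes> v)" using uvx MC by (simp add: m_assoc[symmetric])
    then have "between \<one> (inv u \<otimes> x) (inv u \<otimes> v)"
      using between_one_left[of u x "inv u \<otimes> v"] uvx MC by simp
    moreover have "inv u \<otimes> v \<in> M"
      using uvx subgroup_M by (simp add: subgroup.m_closed subgroup.m_inv_closed)
    ultimately obtain s where s: "s \<in> M" "d (inv u \<otimes> x) s \<le> \<rho>"
      using start[of "inv u \<otimes> v" "inv u \<otimes> x"] uvx MC by auto
    have "d x (u \<otimes> s) = d (inv u \<otimes> x) s"
      using d_left[of u "inv u \<otimes> x" s] uvx MC s by (simp add: m_assoc[symmetric])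
    then show "\<exists>s\<in>M. d x s \<le> \<rho>"
      using s uvx subgroup.m_closed[OF subgroup_M] by (intro bexI[of _ "u \<otimes> s"]) auto
  qed
  then show ?thesis by blast
qed

end

section \<open>The word metric\<close>

locale cayley_metric = group G for G (structure) +
  fixes X :: "'a set"
  assumes fin: "finite X" and X: "X \<subseteq> carrier G" and gen: "generate G X = carrier G"
begin

abbreviation "\<Gamma> \<equiv> cayley_graph G X"
abbreviation "Y \<equiv> sym_gens G X"

sublocale cay: wf_digraph \<Gamma>
  by unfold_locales (use X in \<open>auto simp: cayley_graph_def sym_gens_def\<close>)

definition steps :: "nat \<Rightarrow> 'a \<Rightarrow> 'a \<Rightarrow> bool" where
  "steps n u v \<longleftrightarrow> (\<exists>p. cay.awalk u p v \<and> length p = n)"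

definition dist_nat :: "'a \<Rightarrow> 'a \<Rightarrow> nat" where
  "dist_nat u v = (LEAST n. steps n u v)"

lemma verts: "verts \<Gamma> = carrier G"
  and arcs: "arcs \<Gamma> = carrier G \<times> Y"
  and tail: "tail \<Gamma> (g, x) = g"
  and head: "head \<Gamma> (g, x) = g \<otimes> x"
  by (simp_all add: cayley_graph_def)

lemma Y_carrier: "x \<in> Y \<Longrightarrow> x \<in> carrier G"
  using X by (auto simp: sym_gens_def)

lemma inv_Y: "x \<in> Y \<Longrightarrow> inv x \<in> Y"
  using X by (auto simp: sym_gens_def)

lemma finite_Y: "finite Y"
  using fin by (simp add: sym_gens_def)

section \<open>Walks of a given length\<close>

lemma steps_carrier: "steps n u v \<Longrightarrow> u \<in> carrier G \<and> v \<in> carrier G"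
  using cay.awalk_hd_in_verts cay.awalk_last_in_verts verts by (fastforce simp: steps_def)

lemma steps_0: "steps 0 u v \<longleftrightarrow> u = v \<and> u \<in> carrier G"
  by (auto simp: steps_def cay.awalk_Nil_iff verts)

lemma steps_add: "steps m u v \<Longrightarrow> steps n v w \<Longrightarrow> steps (m + n) u w"
  unfolding steps_def by (metis cay.awalk_appendI length_append)

lemma steps_split: "steps (m + n) u w \<Longrightarrow> \<exists>v. steps m u v \<and> steps n v w"
proof -
  assume "steps (m + n) u w"
  then obtain p where p: "cay.awalk u p w" "length p = m + n" by (auto simp: steps_def)
  have "cay.awalk u (take m p @ drop m p) w" using p by simp
  then have "cay.awalk u (take m p) (cay.awlast u (take m p))"
    "cay.awalk (cay.awlast u (take m p)) (drop m p) w"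
    unfolding cay.awalk_append_iff by auto
  moreover have "length (take m p) = m" "length (drop m p) = n" using p by auto
  ultimately show ?thesis unfolding steps_def by blast
qed

lemma steps_Suc: "steps (Suc n) u w \<longleftrightarrow> u \<in> carrier G \<and> (\<exists>x\<in>Y. steps n (u \<otimes> x) w)"
proof
  assume "steps (Suc n) u w"
  then obtain e p where p: "cay.awalk u (e # p) w" "length p = n"
    by (auto simp: steps_def length_Suc_conv)
  obtain g x where e: "e = (g, x)" by (cases e)
  have "e \<in> arcs \<Gamma>" "u = tail \<Gamma> e" "cay.awalk (head \<Gamma> e) p w"
    using p by (auto simp: cay.awalk_Cons_iff)
  then have x: "u \<in> carrier G" "x \<in> Y" "cay.awalk (u \<otimes> x) p w"
    using e cay.tail_in_verts verts by (auto simp: arcs tail head)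
  then show "u \<in> carrier G \<and> (\<exists>x\<in>Y. steps n (u \<otimes> x) w)"
    using p(2) unfolding steps_def by blast
next
  assume "u \<in> carrier G \<and> (\<exists>x\<in>Y. steps n (u \<otimes> x) w)"
  then obtain x p where x: "u \<in> carrier G" "x \<in> Y" "cay.awalk (u \<otimes> x) p w" "length p = n"
    by (auto simp: steps_def)
  then have "cay.awalk u ((u, x) # p) w"
    by (simp add: cay.awalk_Cons_iff arcs tail head)
  then show "steps (Suc n) u w" using x(4) unfolding steps_def by (metis length_Cons)
qed

lemma steps_1: "u \<in> carrier G \<Longrightarrow> x \<in> Y \<Longrightarrow> steps 1 u (u \<otimes> x)"
  using Y_carrier by (auto simp: steps_Suc steps_0)

lemma steps_left: "g \<in> carrier G \<Longrightarrow> steps n u v \<Longrightarrow> steps n (g \<otimes> u) (g \<otimes> v)"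
proof (induction n arbitrary: u)
  case (Suc n)
  then show ?case using Y_carrier by (fastforce simp: steps_Suc m_assoc)
qed (auto simp: steps_0)

lemma steps_sym: "steps n u v \<Longrightarrow> steps n v u"
proof (induction n arbitrary: u)
  case (Suc n)
  then obtain x where x: "u \<in> carrier G" "x \<in> Y" "steps n (u \<otimes> x) v" by (auto simp: steps_Suc)
  have "steps 1 (u \<otimes> x) u"
    using steps_1[of "u \<otimes> x" "inv x"] x inv_Y Y_carrier by (simp add: m_assoc)
  then show ?case using steps_add[OF Suc.IH[OF x(3)], of 1 u] by simp
qed (auto simp: steps_0)

lemma steps_one_exists: "g \<in> generate G X \<Longrightarrow> \<exists>n. steps n \<one> g"
proof (induction rule: generate.induct)
  case one
  then show ?case using steps_0 by auto
next
  case (incl h)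
  then show ?case using steps_1[of \<one> h] X by (fastforce simp: sym_gens_def)
next
  case (inv h)
  then show ?case using steps_1[of \<one> "inv h"] X by (fastforce simp: sym_gens_def)
next
  case (eng x y)
  then obtain m n where "steps m \<one> x" "steps n \<one> y" by blast
  then have "steps (m + n) \<one> (x \<otimes> y)"
    using steps_left[of x n \<one> y] steps_add steps_carrier by fastforce
  then show ?case by blast
qed

lemma steps_exists: "u \<in> carrier G \<Longrightarrow> v \<in> carrier G \<Longrightarrow> \<exists>n. steps n u v"
  using steps_one_exists[of "inv u \<otimes> v"] steps_left[of u _ \<one> "inv u \<otimes> v"] gen
  by (force simp: m_assoc[symmetric])

section \<open>Metric properties and finiteness of balls\<close>

lemma steps_dist: "u \<in> carrier G \<Longrightarrow> v \<in> carrier G \<Longrightarrow> steps (dist_nat u v) u v"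
  unfolding dist_nat_def by (rule LeastI_ex[OF steps_exists])

lemma dist_nat_le: "steps n u v \<Longrightarrow> dist_nat u v \<le> n"
  unfolding dist_nat_def by (rule Least_le)

lemma dist_nat_triangle:
  assumes "u \<in> carrier G" "v \<in> carrier G" "w \<in> carrier G"
  shows "dist_nat u w \<le> dist_nat u v + dist_nat v w"
  using assms by (intro dist_nat_le steps_add[of _ u v]) (auto intro: steps_dist)

lemma dist_nat_commute_le:
  "u \<in> carrier G \<Longrightarrow> v \<in> carrier G \<Longrightarrow> dist_nat u v \<le> dist_nat v u"
  by (rule dist_nat_le[OF steps_sym[OF steps_dist]])

lemma dist_nat_commute: "u \<in> carrier G \<Longrightarrow> v \<in> carrier G \<Longrightarrow> dist_nat u v = dist_nat v u"
  using dist_nat_commute_le by (simp add: antisym)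

lemma dist_nat_eq_0_iff:
  assumes "u \<in> carrier G" "v \<in> carrier G"
  shows "dist_nat u v = 0 \<longleftrightarrow> u = v"
proof
  assume "dist_nat u v = 0"
  then have "steps 0 u v" using steps_dist[OF assms] by simp
  then show "u = v" by (simp add: steps_0)
next
  assume "u = v"
  then have "steps 0 u v" using assms by (simp add: steps_0)
  from dist_nat_le[OF this] show "dist_nat u v = 0" by simp
qed

lemma dist_nat_left_le:
  "g \<in> carrier G \<Longrightarrow> u \<in> carrier G \<Longrightarrow> v \<in> carrier G \<Longrightarrow> dist_nat (g \<otimes> u) (g \<otimes> v) \<le> dist_nat u v"
  by (intro dist_nat_le steps_left steps_dist)

lemma dist_nat_left:
  assumes "g \<in> carrier G" "u \<in> carrier G" "v \<in> carrier G"
  shows "dist_nat (g \<otimes> u) (g \<otimes> v) = dist_nat u v"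
  using dist_nat_left_le[of g u v] dist_nat_left_le[of "inv g" "g \<otimes> u" "g \<otimes> v"] assms
  by (simp add: m_assoc[symmetric])

lemma finite_steps: "finite {v. steps n u v}"
proof (induction n arbitrary: u)
  case 0
  then show ?case by (simp add: steps_0)
next
  case (Suc n)
  have "{v. steps (Suc n) u v} \<subseteq> (\<Union>x\<in>Y. {v. steps n (u \<otimes> x) v})" by (auto simp: steps_Suc)
  then show ?case using finite_Y Suc finite_subset by blast
qed

lemma finite_dist_ball: "finite {v \<in> carrier G. real (dist_nat \<one> v) \<le> r}"
proof (rule finite_subset)
  show "{v \<in> carrier G. real (dist_nat \<one> v) \<le> r} \<subseteq> (\<Union>n\<in>{..nat \<lfloor>r\<rfloor>}. {v. steps n \<one> v})"
    using steps_dist[of \<one>] by (force simp: le_nat_floor)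
qed (simp add: finite_steps)

text \<open>Cutting a shortest walk after \<open>n\<close> arcs leaves two shortest walks, by the
  triangle inequality.\<close>

lemma dist_nat_point:
  assumes "u \<in> carrier G" "v \<in> carrier G" "n \<le> dist_nat u v"
  shows "\<exists>w\<in>carrier G. dist_nat u w + dist_nat w v = dist_nat u v \<and> dist_nat u w = n"
proof -
  have "steps (n + (dist_nat u v - n)) u v" using steps_dist assms by simp
  then obtain w where w: "steps n u w" "steps (dist_nat u v - n) w v" using steps_split by blast
  then have "dist_nat u w \<le> n" "dist_nat w v \<le> dist_nat u v - n" "w \<in> carrier G"
    using dist_nat_le steps_carrier by auto
  moreover have "dist_nat u v \<le> dist_nat u w + dist_nat w v"
    using dist_nat_triangle assms calculation by blast
  ultimately show ?thesis using assms(3) by (intro bexI[of _ w]) auto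
qed

section \<open>Geodesics and neighbourhoods in terms of distances\<close>

lemma geodesic_iff: "geodesic \<Gamma> u p v \<longleftrightarrow> cay.awalk u p v \<and> length p = dist_nat u v"
proof
  assume g: "geodesic \<Gamma> u p v"
  then have p: "cay.awalk u p v" by (simp add: geodesic_def)
  then have "steps (length p) u v" by (auto simp: steps_def)
  moreover from this obtain q where "cay.awalk u q v" "length q = dist_nat u v"
    using steps_dist steps_carrier unfolding steps_def by blast
  ultimately show "cay.awalk u p v \<and> length p = dist_nat u v"
    using g p dist_nat_le by (force simp: geodesic_def)
next
  assume "cay.awalk u p v \<and> length p = dist_nat u v"
  then show "geodesic \<Gamma> u p v"
    using dist_nat_le by (auto simp: geodesic_def steps_def)
qed

lemma geodesic_exists:
  "u \<in> carrier G \<Longrightarrow> v \<in> carrier G \<Longrightarrow> \<exists>p. geodesic \<Gamma> u p v"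
  using steps_dist unfolding geodesic_iff steps_def by blast

lemma path_vertices_geodesic:
  assumes "geodesic \<Gamma> u p v" "x \<in> path_vertices \<Gamma> u p"
  shows "x \<in> carrier G \<and> dist_nat u x + dist_nat x v = dist_nat u v"
proof -
  have p: "cay.awalk u p v" "length p = dist_nat u v" using assms(1) by (auto simp: geodesic_iff)
  obtain q r where qr: "p = q @ r" "cay.awalk u q x" "cay.awalk x r v"
    using cay.awalk_decomp[OF p(1), of x] assms(2) unfolding path_vertices_def by blast
  then have "steps (length q) u x" "steps (length r) x v" by (auto simp: steps_def)
  then have "dist_nat u x \<le> length q" "dist_nat x v \<le> length r"
    "u \<in> carrier G" "x \<in> carrier G" "v \<in> carrier G"
    using dist_nat_le steps_carrier by blast+
  then show ?thesis using dist_nat_triangle[of u x v] p qr by simp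
qed

text \<open>Geodesics from \<open>u\<close> to \<open>x\<close> and from \<open>x\<close> to
  \<open>v\<close> concatenate to a walk of minimal length. With
  \<open>path_vertices_geodesic\<close> this lets additive distances replace paths.\<close>

lemma between_on_geodesic:
  assumes "u \<in> carrier G" "x \<in> carrier G" "v \<in> carrier G"
    "dist_nat u x + dist_nat x v = dist_nat u v"
  shows "\<exists>p. geodesic \<Gamma> u p v \<and> x \<in> path_vertices \<Gamma> u p"
proof -
  obtain q r where q: "geodesic \<Gamma> u q x" and r: "geodesic \<Gamma> x r v"
    using geodesic_exists[OF assms(1,2)] geodesic_exists[OF assms(2,3)] by blast
  then have qr: "cay.awalk u q x" "cay.awalk x r v" by (auto simp: geodesic_iff)
  have "geodesic \<Gamma> u (q @ r) v"
    using q r assms(4) cay.awalk_appendI by (auto simp: geodesic_iff)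
  moreover have "x \<in> set (cay.awalk_verts u (q @ r))"
    using cay.hd_in_awalk_verts(1)[OF qr(2)] cay.set_awalk_verts_append[OF qr] by simp
  ultimately show ?thesis by (auto simp: path_vertices_def)
qed

lemma graph_neighborhood_iff:
  assumes "S \<subseteq> carrier G"
  shows "v \<in> graph_neighborhood \<Gamma> r S \<longleftrightarrow> v \<in> carrier G \<and> (\<exists>s\<in>S. real (dist_nat v s) \<le> r)"
proof
  assume "v \<in> graph_neighborhood \<Gamma> r S"
  then obtain s p where s: "s \<in> S" "cay.awalk s p v" "real (length p) \<le> r"
    by (auto simp: graph_neighborhood_def)
  then have "steps (length p) s v" by (auto simp: steps_def)
  then show "v \<in> carrier G \<and> (\<exists>s\<in>S. real (dist_nat v s) \<le> r)"
    using s dist_nat_le[OF steps_sym] steps_carrier by (meson of_nat_mono order_trans)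
next
  assume "v \<in> carrier G \<and> (\<exists>s\<in>S. real (dist_nat v s) \<le> r)"
  then obtain s where s: "s \<in> S" "real (dist_nat v s) \<le> r" "v \<in> carrier G" by blast
  moreover have "steps (dist_nat v s) s v"
    using steps_dist[of v s] steps_sym s assms by blast
  ultimately show "v \<in> graph_neighborhood \<Gamma> r S"
    unfolding graph_neighborhood_def steps_def by fastforce
qed

lemma quasiconvex_iff:
  assumes "S \<subseteq> carrier G"
  shows "quasiconvex G X S \<longleftrightarrow> (\<exists>\<mu>. \<forall>u\<in>S. \<forall>v\<in>S. \<forall>x\<in>carrier G.
    dist_nat u x + dist_nat x v = dist_nat u v \<longrightarrow> (\<exists>s\<in>S. real (dist_nat x s) \<le> \<mu>))"
    (is "_ \<longleftrightarrow> (\<exists>\<mu>. ?Q \<mu>)")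
proof
  assume "quasiconvex G X S"
  then obtain \<mu> where \<mu>: "\<And>u v p. u \<in> S \<Longrightarrow> v \<in> S \<Longrightarrow> geodesic \<Gamma> u p v \<Longrightarrow>
      path_vertices \<Gamma> u p \<subseteq> graph_neighborhood \<Gamma> \<mu> S"
    unfolding quasiconvex_def by blast
  have "?Q \<mu>"
  proof (intro ballI impI)
    fix u v x
    assume u: "u \<in> S" "v \<in> S" "x \<in> carrier G" "dist_nat u x + dist_nat x v = dist_nat u v"
    then obtain p where "geodesic \<Gamma> u p v" "x \<in> path_vertices \<Gamma> u p"
      using between_on_geodesic[of u x v] assms by blast
    then show "\<exists>s\<in>S. real (dist_nat x s) \<le> \<mu>"
      using \<mu>[OF u(1,2)] graph_neighborhood_iff[OF assms] by blast
  qed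
  then show "\<exists>\<mu>. ?Q \<mu>" by blast
next
  assume "\<exists>\<mu>. ?Q \<mu>"
  then obtain \<mu> where \<mu>: "?Q \<mu>" by blast
  \<comment> \<open>The absolute value supplies the nonnegative constant that
    \<open>quasiconvex\<close> requires.\<close>
  have "path_vertices \<Gamma> u p \<subseteq> graph_neighborhood \<Gamma> \<bar>\<mu>\<bar> S"
    if u: "u \<in> S" "v \<in> S" "geodesic \<Gamma> u p v" for u v p
  proof
    fix x
    assume "x \<in> path_vertices \<Gamma> u p"
    then have x: "x \<in> carrier G" "dist_nat u x + dist_nat x v = dist_nat u v"
      using path_vertices_geodesic[OF u(3)] by auto
    then obtain s where "s \<in> S" "real (dist_nat x s) \<le> \<mu>" using \<mu> u by blast
    then show "x \<in> graph_neighborhood \<Gamma> \<bar>\<mu>\<bar> S"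
      unfolding graph_neighborhood_iff[OF assms] using x by (auto intro!: bexI[of _ s])
  qed
  then show "quasiconvex G X S"
    unfolding quasiconvex_def by (intro exI[of _ "\<bar>\<mu>\<bar>"]) auto
qed

text \<open>The side from \<open>a\<close> to \<open>b\<close> is chosen to pass through
  \<open>x\<close>; the other two sides are arbitrary geodesics.\<close>

lemma dist_nat_thin:
  assumes "delta_negatively_curved G X \<delta>"
    and C: "a \<in> carrier G" "b \<in> carrier G" "c \<in> carrier G" "x \<in> carrier G"
    and x: "dist_nat a x + dist_nat x b = dist_nat a b"
  shows "\<exists>y\<in>carrier G. real (dist_nat x y) \<le> \<delta> \<and>
    (dist_nat b y + dist_nat y c = dist_nat b c \<or> dist_nat c y + dist_nat y a = dist_nat c a)"
proof -
  obtain p where p: "geodesic \<Gamma> a p b" "x \<in> path_vertices \<Gamma> a p"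
    using between_on_geodesic[OF C(1,4,2) x] by blast
  obtain q r where qr: "geodesic \<Gamma> b q c" "geodesic \<Gamma> c r a"
    using geodesic_exists[OF C(2,3)] geodesic_exists[OF C(3,1)] by blast
  have "path_vertices \<Gamma> a p \<subseteq> graph_neighborhood \<Gamma> \<delta> (path_vertices \<Gamma> b q \<union> path_vertices \<Gamma> c r)"
    using assms(1) p(1) qr unfolding delta_negatively_curved_def Let_def by blast
  moreover have "path_vertices \<Gamma> b q \<union> path_vertices \<Gamma> c r \<subseteq> carrier G"
    using path_vertices_geodesic qr by blast
  ultimately obtain y where "y \<in> path_vertices \<Gamma> b q \<union> path_vertices \<Gamma> c r"
      "real (dist_nat x y) \<le> \<delta>"
    using p(2) graph_neighborhood_iff by blast
  then show ?thesis using path_vertices_geodesic qr by blast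
qed

lemma hyperbolic_group_dist:
  assumes "delta_negatively_curved G X \<delta>"
  shows "hyperbolic_group G (\<lambda>u v. real (dist_nat u v)) \<delta>"
proof (unfold_locales, goal_cases)
  case (1 x y)
  then show ?case by simp
next
  case (2 x y)
  then show ?case using dist_nat_eq_0_iff by simp
next
  case (3 x y)
  then show ?case using dist_nat_commute by simp
next
  case (4 x y z)
  then show ?case using dist_nat_triangle by (metis of_nat_add of_nat_mono)
next
  case (5 g x y)
  then show ?case using dist_nat_left by simp
next
  case (6 r)
  then show ?case by (rule finite_dist_ball)
next
  case (7 x y n)
  then show ?case using dist_nat_point[of x y n] by (metis of_nat_add of_nat_le_iff)
next
  case (8 a b c x)
  then have "dist_nat a x + dist_nat x b = dist_nat a b" by (metis of_nat_add of_nat_eq_iff)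
  from dist_nat_thin[OF assms 8(1-4) this] show ?case by (metis of_nat_add)
qed

end

section \<open>Combination of a malnormal and a quasiconvex subgroup\<close>

context hyperbolic_group
begin

text \<open>Both bounds come from \<open>gp_bounded_of_trivial_conjugates\<close>: with conjugator
  \<open>\<one>\<close> for \<open>H\<close> and \<open>K\<close>, and with conjugator
  \<open>k\<close> for \<open>H\<close> and itself, where malnormality applies because
  \<open>k\<close> is not in \<open>H\<close>.\<close>

lemma gp_bounded_of_malnormal:
  assumes H: "subgroup H G" "convex_within \<mu> H" and K: "subgroup K G" "convex_within \<nu> K"
    and mal: "malnormal G H" and HK: "H \<inter> K = {\<one>}"
  shows "\<exists>b. (\<forall>h\<in>H. \<forall>k\<in>K. gp h k \<le> b) \<and>
    (\<forall>h\<in>H. \<forall>h'\<in>H. \<forall>k\<in>K. k \<noteq> \<one> \<longrightarrow> gp h (k \<otimes> h') \<le> b)"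
proof -
  have HC: "x \<in> carrier G" if "x \<in> H" for x using subgroup.mem_carrier[OF H(1) that] .
  have KC: "x \<in> carrier G" if "x \<in> K" for x using subgroup.mem_carrier[OF K(1) that] .
  obtain a where "\<forall>\<alpha>\<in>H. \<forall>\<beta>\<in>K. gp \<alpha> (\<one> \<otimes> \<beta>) \<le> a"
    using gp_bounded_of_trivial_conjugates[OF H K one_closed] HC KC HK by fastforce
  then have a: "gp h k \<le> a" if "h \<in> H" "k \<in> K" for h k using that KC by simp
  have "\<exists>c. \<forall>h\<in>H. \<forall>h'\<in>H. gp h (k \<otimes> h') \<le> c" if k: "k \<in> K" "k \<noteq> \<one>" for k
  proof (rule gp_bounded_of_trivial_conjugates[OF H H KC[OF k(1)]])
    fix \<alpha> \<beta>
    assume ab: "\<alpha> \<in> H" "\<beta> \<in> H" "\<alpha> \<otimes> k = k \<otimes> \<beta>"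
    then have "\<alpha> = k \<otimes> \<beta> \<otimes> inv k"
      using HC KC[OF k(1)] by (metis inv_solve_right m_closed)
    then have "\<alpha> \<in> k <# H #> inv k"
      using ab by (auto simp: l_coset_def r_coset_def)
    moreover have "k \<in> carrier G - H" using k HK KC by auto
    ultimately show "\<alpha> = \<one>" using mal ab unfolding malnormal_def by blast
  qed
  then obtain c where c: "\<And>k h h'. k \<in> K \<Longrightarrow> k \<noteq> \<one> \<Longrightarrow> h \<in> H \<Longrightarrow> h' \<in> H \<Longrightarrow> gp h (k \<otimes> h') \<le> c k"
    by metis
  \<comment> \<open>For \<open>k\<close> outside this finite ball, \<open>k \<otimes> h'\<close>
    follows \<open>k\<close> for more than \<open>a + \<epsilon>\<close>, whereas \<open>h\<close>
    leaves \<open>k\<close> after at most \<open>a\<close>; so the bound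
    \<open>a + \<epsilon>\<close> holds. The finitely many remaining \<open>k\<close> contribute the
    maximum of their own constants.\<close>
  define F where "F = {k \<in> carrier G. d \<one> k \<le> 2 * a + \<epsilon>}"
  have "finite (c ` F)" unfolding F_def by (intro finite_imageI finite_ball)
  then obtain C where C: "\<And>k. k \<in> F \<Longrightarrow> c k \<le> C"
    using bdd_above_finite[of "c ` F"] by (auto simp: bdd_above_def)
  define b where "b = max (a + \<epsilon>) C"
  have "gp h (k \<otimes> h') \<le> b" if hk: "h \<in> H" "h' \<in> H" "k \<in> K" "k \<noteq> \<one>" for h h' k
  proof (cases "k \<in> F")
    case True
    then show ?thesis using c[of k h h'] hk C[of k] by (simp add: b_def)
  next
    case False
    have G: "h \<in> carrier G" "h' \<in> carrier G" "k \<in> carrier G" using hk HC KC by auto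
    have "gp (inv k) h' \<le> a"
      using a[of h' "inv k"] hk subgroup.m_inv_closed[OF K(1)] gp_commute[of "inv k" h'] G by simp
    moreover have "gp (inv k) h' = len k - gp k (k \<otimes> h')" using gp_inv_left[of k h'] G by simp
    moreover have "2 * a + \<epsilon> < len k" using False G by (simp add: F_def len_def)
    ultimately have "a + \<epsilon> < gp (k \<otimes> h') k" using gp_commute[of k "k \<otimes> h'"] G by simp
    moreover have "min (gp h (k \<otimes> h')) (gp (k \<otimes> h') k) \<le> gp h k + \<epsilon>"
      using gromov_inequality[of h "k \<otimes> h'" k] G by simp
    ultimately show ?thesis using a[of h k] hk by (auto simp: b_def min_le_iff_disj)
  qed
  moreover have "gp h k \<le> b" if "h \<in> H" "k \<in> K" for h k
    using a[OF that] delta_nonneg by (simp add: b_def \<epsilon>_def)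
  ultimately show ?thesis by blast
qed

text \<open>If \<open>l \<otimes> h\<close> is the chosen representative of the coset of
  \<open>h\<close>, then \<open>inv l\<close> lies at distance \<open>len (l \<otimes> h)\<close>
  from \<open>h\<close>, and there are finitely many representatives.\<close>

lemma finite_index_near:
  assumes H: "subgroup H G" and L: "finite_index_subgroup L (G\<lparr>carrier := H\<rparr>)"
  shows "\<exists>\<rho>. \<forall>h\<in>H. \<exists>l\<in>L. d h l \<le> \<rho>"
proof -
  let ?H = "G\<lparr>carrier := H\<rparr>"
  have HC: "x \<in> carrier G" if "x \<in> H" for x using subgroup.mem_carrier[OF H that] .
  have sub: "subgroup L ?H" and fin: "finite (rcosets\<^bsub>?H\<^esub> L)"
    using L by (auto simp: finite_index_subgroup_def)
  have LH: "L \<subseteq> H" using subgroup.subset[OF sub] by simp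
  have LG: "subgroup L G" using incl_subgroup[OF H sub] .
  have "finite ((\<lambda>R. len (SOME x. x \<in> R)) ` (rcosets\<^bsub>?H\<^esub> L))" using fin by simp
  then obtain \<rho> where \<rho>: "\<And>R. R \<in> rcosets\<^bsub>?H\<^esub> L \<Longrightarrow> len (SOME x. x \<in> R) \<le> \<rho>"
    using bdd_above_finite by (force simp: bdd_above_def)
  have "\<exists>l\<in>L. d h l \<le> \<rho>" if h: "h \<in> H" for h
  proof -
    let ?R = "L #>\<^bsub>?H\<^esub> h"
    have R: "?R \<in> rcosets\<^bsub>?H\<^esub> L" using h by (auto simp: RCOSETS_def)
    have "\<one> \<otimes> h \<in> ?R" using subgroup.one_closed[OF LG] by (auto simp: r_coset_def)
    then have "(SOME x. x \<in> ?R) \<in> ?R" by (rule someI)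
    then obtain l where l: "l \<in> L" "(SOME x. x \<in> ?R) = l \<otimes> h" by (auto simp: r_coset_def)
    have C: "l \<in> carrier G" "h \<in> carrier G" using l h LH HC by auto
    have "d h (inv l) = len (inv (l \<otimes> h))" using d_eq_len[of h "inv l"] C by (simp add: inv_mult_group)
    also have "\<dots> \<le> \<rho>" using \<rho>[OF R] l C by simp
    finally show ?thesis using l subgroup.m_inv_closed[OF LG] by blast
  qed
  then show ?thesis by blast
qed

text \<open>Were \<open>L\<close> trivial, \<open>H\<close> would lie in a ball and be
  finite.\<close>

lemma finite_index_nontrivial:
  assumes "subgroup H G" "infinite H" "finite_index_subgroup L (G\<lparr>carrier := H\<rparr>)"
  shows "\<exists>l\<in>L. l \<noteq> \<one>"
proof (rule ccontr)
  assume neg: "\<not> ?thesis"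
  obtain \<rho> where \<rho>: "\<And>h. h \<in> H \<Longrightarrow> \<exists>l\<in>L. d h l \<le> \<rho>"
    using finite_index_near assms by blast
  have "H \<subseteq> {x \<in> carrier G. d \<one> x \<le> \<rho>}"
    using \<rho> neg subgroup.mem_carrier[OF assms(1)] d_commute by fastforce
  then show False using finite_ball assms(2) finite_subset by blast
qed

lemma finite_index_convex:
  assumes H: "subgroup H G" "convex_within \<mu> H" and L: "finite_index_subgroup L (G\<lparr>carrier := H\<rparr>)"
  shows "\<exists>\<rho>. convex_within \<rho> L"
proof -
  obtain \<rho> where \<rho>: "\<And>h. h \<in> H \<Longrightarrow> \<exists>l\<in>L. d h l \<le> \<rho>" using finite_index_near H L by blast
  have LH: "L \<subseteq> H" using L subgroup.subset by (fastforce simp: finite_index_subgroup_def)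
  have HC: "x \<in> carrier G" if "x \<in> H" for x using subgroup.mem_carrier[OF H(1) that] .
  have "convex_within (\<mu> + \<rho>) L"
    unfolding convex_within_def
  proof (intro ballI impI)
    fix u v x
    assume "u \<in> L" "v \<in> L" and x: "x \<in> carrier G" "between u x v"
    then obtain h where h: "h \<in> H" "d x h \<le> \<mu>" using convex_withinD[OF H(2), of u v x] LH by blast
    obtain l where l: "l \<in> L" "d h l \<le> \<rho>" using \<rho>[OF h(1)] by blast
    have "d x l \<le> \<mu> + \<rho>" using d_triangle[of x h l] x h l HC LH by fastforce
    then show "\<exists>s\<in>L. d x s \<le> \<mu> + \<rho>" using l by blast
  qed
  then show ?thesis by blast
qed

text \<open>The set \<open>F\<close> consists of the short nontrivial elements of \<open>H\<close>.
  It is fixed before \<open>L\<close>, since the bound \<open>b\<close> for \<open>H\<close> is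
  inherited by each subgroup; residual finiteness can thus produce many \<open>L\<close> from one
  \<open>F\<close>.\<close>

lemma free_product_of_long_finite_index:
  assumes H: "subgroup H G" "convex_within \<mu> H" and K: "subgroup K G" "convex_within \<nu> K"
    and "malnormal G H" "H \<inter> K = {\<one>}"
  shows "\<exists>F. finite F \<and> F \<subseteq> H - {\<one>} \<and>
    (\<forall>L. finite_index_subgroup L (G\<lparr>carrier := H\<rparr>) \<and> L \<inter> F = {} \<longrightarrow>
      is_internal_free_product G L K \<and> (\<exists>\<rho>. convex_within \<rho> (generate G (L \<union> K))))"
proof -
  obtain b where b: "\<And>h k. h \<in> H \<Longrightarrow> k \<in> K \<Longrightarrow> gp h k \<le> b"
    "\<And>h h' k. h \<in> H \<Longrightarrow> h' \<in> H \<Longrightarrow> k \<in> K \<Longrightarrow> k \<noteq> \<one> \<Longrightarrow> gp h (k \<otimes> h') \<le> b"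
    using gp_bounded_of_malnormal[OF assms] by blast
  define B where "B = {x \<in> carrier G. d \<one> x \<le> 4 * b + 3 * \<epsilon>}"
  have "finite B" unfolding B_def by (rule finite_ball)
  moreover have "is_internal_free_product G L K \<and> (\<exists>\<rho>. convex_within \<rho> (generate G (L \<union> K)))"
    if L: "finite_index_subgroup L (G\<lparr>carrier := H\<rparr>)" "L \<inter> (B \<inter> (H - {\<one>})) = {}" for L
  proof -
    have sub: "subgroup L (G\<lparr>carrier := H\<rparr>)" using L by (simp add: finite_index_subgroup_def)
    have LH: "L \<subseteq> H" using subgroup.subset[OF sub] by simp
    interpret ff: free_factors G d \<delta> L K b
    proof (intro free_factors.intro free_factors_axioms.intro hyperbolic_group_axioms)
      show "subgroup L G" using incl_subgroup[OF H(1) sub] .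
      show "subgroup K G" by (rule K(1))
      show "4 * b + 3 * \<epsilon> < len h" if "h \<in> L" "h \<noteq> \<one>" for h
      proof -
        have "h \<in> H" using that LH by blast
        then have "h \<in> carrier G" using subgroup.mem_carrier[OF H(1)] by blast
        then show ?thesis using that L(2) \<open>h \<in> H\<close> by (force simp: B_def len_def)
      qed
    qed (use b LH in blast)+
    obtain \<rho> where "convex_within \<rho> L" using finite_index_convex[OF H L(1)] by blast
    then show ?thesis using ff.internal_free_product ff.convex_within_M K(2) by blast
  qed
  ultimately show ?thesis by (intro exI[of _ "B \<inter> (H - {\<one>})"]) auto
qed

end

lemma (in cayley_metric) quasiconvex_iff_convex_within:
  assumes "delta_negatively_curved G X \<delta>" "S \<subseteq> carrier G"
  shows "quasiconvex G X S \<longleftrightarrow>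
    (\<exists>\<mu>. hyperbolic_group.convex_within G (\<lambda>u v. real (dist_nat u v)) \<mu> S)"
proof -
  interpret hyp: hyperbolic_group G "\<lambda>u v. real (dist_nat u v)" \<delta>
    by (rule hyperbolic_group_dist[OF assms(1)])
  show ?thesis
    unfolding quasiconvex_iff[OF assms(2)] hyp.convex_within_def hyp.between_def
    by (simp only: of_nat_add[symmetric] of_nat_eq_iff)
qed

theorem corollary4:
  fixes G :: "('a, 'm) monoid_scheme" and X H K :: "'a set"
  assumes "group G"
    and "finite X" and "X \<subseteq> carrier G" and "generate G X = carrier G"
    and "negatively_curved G X"
    and "subgroup H G" and "infinite H" and "quasiconvex G X H"
    and "subgroup K G" and "infinite K" and "quasiconvex G X K"
    and "malnormal G H"
    and "residually_finite (G\<lparr>carrier := H\<rparr>)"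
    and "H \<inter> K = {\<one>\<^bsub>G\<^esub>}"
  shows "\<exists>Hs :: nat \<Rightarrow> 'a set. inj Hs \<and>
    (\<forall>m. finite_index_subgroup (Hs m) (G\<lparr>carrier := H\<rparr>) \<and>
      quasiconvex G X (generate G (Hs m \<union> K)) \<and>
      is_internal_free_product G (Hs m) K)"
proof -
  interpret cayley_metric G X
    using assms(1-4) by (simp add: cayley_metric_def cayley_metric_axioms_def)
  obtain \<delta> where \<delta>: "delta_negatively_curved G X \<delta>"
    using assms(5) by (auto simp: negatively_curved_def)
  interpret hyp: hyperbolic_group G "\<lambda>u v. real (dist_nat u v)" \<delta>
    by (rule hyperbolic_group_dist[OF \<delta>])
  note qc_iff = quasiconvex_iff_convex_within[OF \<delta>]
  let ?H = "G\<lparr>carrier := H\<rparr>"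
  have HC: "H \<subseteq> carrier G" and KC: "K \<subseteq> carrier G"
    using assms(6,9) subgroup.subset by auto
  obtain \<mu> where \<mu>: "hyp.convex_within \<mu> H"
    using qc_iff[OF HC, THEN iffD1, OF assms(8)] ..
  obtain \<nu> where \<nu>: "hyp.convex_within \<nu> K"
    using qc_iff[OF KC, THEN iffD1, OF assms(11)] ..
  obtain F where F: "finite F" "F \<subseteq> H - {\<one>\<^bsub>G\<^esub>}"
    and good: "\<forall>L. finite_index_subgroup L ?H \<and> L \<inter> F = {} \<longrightarrow>
      is_internal_free_product G L K \<and> (\<exists>\<rho>. hyp.convex_within \<rho> (generate G (L \<union> K)))"
    using hyp.free_product_of_long_finite_index[OF assms(6) \<mu> assms(9) \<nu> assms(12,14)]
    by (elim exE conjE)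
  define \<S> where "\<S> = {L. finite_index_subgroup L ?H \<and> L \<inter> F = {}}"
  have "infinite \<S>"
  proof
    assume fin: "finite \<S>"
    \<comment> \<open>One nontrivial element is picked from each member of \<open>\<S>\<close>. A
      finite index subgroup avoiding these and \<open>F\<close> again belongs to
      \<open>\<S>\<close>, yet misses the element picked from itself.\<close>
    have "\<forall>L\<in>\<S>. \<exists>l\<in>L. l \<noteq> \<one>\<^bsub>G\<^esub>"
      using hyp.finite_index_nontrivial[OF assms(6,7)] by (auto simp: \<S>_def)
    then obtain l where l: "\<And>L. L \<in> \<S> \<Longrightarrow> l L \<in> L \<and> l L \<noteq> \<one>\<^bsub>G\<^esub>" by metis
    have "l L \<in> H" if "L \<in> \<S>" for L
      using l[OF that] that subgroup.subset[of L ?H] by (auto simp: \<S>_def finite_index_subgroup_def)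
    then have "F \<union> l ` \<S> \<subseteq> carrier ?H - {\<one>\<^bsub>?H\<^esub>}" using F(2) l by auto
    moreover have "finite (F \<union> l ` \<S>)" using F fin by simp
    ultimately obtain L where L: "finite_index_subgroup L ?H" "L \<inter> (F \<union> l ` \<S>) = {}"
      using assms(13)[unfolded residually_finite_def, rule_format, of "F \<union> l ` \<S>"] by auto
    then have "L \<in> \<S>" by (auto simp: \<S>_def)
    then show False using l[of L] L by blast
  qed
  then obtain Hs :: "nat \<Rightarrow> 'a set" where Hs: "inj Hs" "range Hs \<subseteq> \<S>"
    using infinite_countable_subset by blast
  have "finite_index_subgroup (Hs m) ?H \<and> quasiconvex G X (generate G (Hs m \<union> K)) \<and>
      is_internal_free_product G (Hs m) K" for m
  proof -
    have m: "finite_index_subgroup (Hs m) ?H" "Hs m \<inter> F = {}" using Hs(2) by (auto simp: \<S>_def)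
    have "Hs m \<subseteq> H" using m(1) subgroup.subset by (fastforce simp: finite_index_subgroup_def)
    then have "generate G (Hs m \<union> K) \<subseteq> carrier G" using HC KC by (intro generate_incl) auto
    from qc_iff[OF this] show ?thesis using m good by simp
  qed
  then show ?thesis using Hs(1) by blast
qed

end
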